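(* Let $\mathfrak{A}$ be a unital C*-algebra, $\mathfrak{H}$ a Hilbert $\mathfrak{A}$-module, $(\mathfrak{H}_n)_{n\in\mathbb{N}^*}$ a sequence of orthogonally complemented submodules of $\mathfrak{H}$ and $(\omega_n)_{n\in\mathbb{N}^*}$ a weight of the C*-algebra $\mathfrak{A}$. Then $((\mathfrak{H}_n,\omega_n))_{n\in\mathbb{N}^*}$ is a *-fusion frame of $\mathfrak{H}$ if and only if the series $\sum\omega_n^2|P_{\mathfrak{H}_n}(x)|^2$ is convergent (in the norm of $\mathfrak{A}$) for every $x\in\mathfrak{H}$ and there exist real constants $c,d>0$ such that $$c\|x\|_{\mathfrak{H}}^2\le\left\|\sum_{n=1}^{+\infty}\omega_n^2|P_{\mathfrak{H}_n}(x)|^2\right\|_{\mathfrak{A}}\le d\|x\|_{\mathfrak{H}}^2,\qquad x\in\mathfrak{H}.$$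
   Context: $\mathbb{N}^*=\{1,2,3,\dots\}$. Hilbert $\mathfrak{A}$-modules are left modules with $\mathfrak{A}$-valued inner product $\langle\cdot,\cdot\rangle$ that is $\mathfrak{A}$-linear in the first variable; $|x|:=\langle x,x\rangle^{1/2}\in\mathfrak{A}$ and $\|x\|_{\mathfrak{H}}:=\||x|\|_{\mathfrak{A}}$. For $a,b\in\mathfrak{A}$, $a\preccurlyeq b$ means that $b-a$ is positive. An element of $\mathfrak{A}$ is strictly positive if every nonzero positive linear form takes a value $>0$ on it; since $\mathfrak{A}$ is unital this is equivalent to being positive and invertible. A closed submodule $\mathfrak{K}$ of $\mathfrak{H}$ is orthogonally complemented if $\mathfrak{H}=\mathfrak{K}\oplus\mathfrak{K}^\perp$, where $\mathfrak{K}^\perp=\{u\in\mathfrak{H}:\langle u,x\rangle=0\ \forall x\in\mathfrak{K}\}$; $P_{\mathfrak{K}}$ denotes the corresponding orthogonal projection of $\mathfrak{H}$ onto $\mathfrak{K}$. A weight of $\mathfrak{A}$ is a sequence $(\omega_n)_{n\in\mathbb{N}^*}$ of central and strictly positive elements of $\mathfrak{A}$. Given a sequence $(\mathfrak{H}_n)_{n\in\mathbb{N}^*}$ of orthogonally complemented submodules of $\mathfrak{H}$ and a weight $(\omega_n)_{n\in\mathbb{N}^*}$ of $\mathfrak{A}$, the sequence $((\mathfrak{H}_n,\omega_n))_{n\in\mathbb{N}^*}$ is a *-fusion frame of $\mathfrak{H}$ if for each $x\in\mathfrak{H}$ the series $\sum\omega_n^2|P_{\mathfrak{H}_n}(x)|^2$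 converges in the norm of $\mathfrak{A}$ and there exist two strictly positive elements $A,B$ of $\mathfrak{A}$ such that $|Ax|^2\preccurlyeq\sum_{n=1}^{+\infty}\omega_n^2|P_{\mathfrak{H}_n}(x)|^2\preccurlyeq|Bx|^2$ for all $x\in\mathfrak{H}$. *)

theory Defs
  imports "HOL-Analysis.Analysis"
begin

section \<open>Unital C*-algebras\<close>

class complex_banach = banach +
  fixes scaleC :: "complex \<Rightarrow> 'a \<Rightarrow> 'a"  (infixr "*\<^sub>C" 75)
  assumes scaleC_add_right: "c *\<^sub>C (x + y) = c *\<^sub>C x + c *\<^sub>C y"
    and scaleC_add_left: "(c + d) *\<^sub>C x = c *\<^sub>C x + d *\<^sub>C x"
    and scaleC_scaleC: "c *\<^sub>C d *\<^sub>C x = (c * d) *\<^sub>C x"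
    and scaleC_one: "1 *\<^sub>C x = x"
    and scaleR_scaleC: "r *\<^sub>R x = complex_of_real r *\<^sub>C x"
    and norm_scaleC: "norm (c *\<^sub>C x) = cmod c * norm x"

text \<open>The unit comes from the class \<open>monoid_mult\<close> rather than \<open>real_normed_algebra_1\<close>,
  so that the zero algebra is allowed.\<close>

class unital_cstar_algebra = complex_banach + real_normed_algebra + monoid_mult +
  fixes star :: "'a \<Rightarrow> 'a"
  assumes mult_scaleC_left: "(c *\<^sub>C a) * b = c *\<^sub>C (a * b)"
    and mult_scaleC_right: "a * (c *\<^sub>C b) = c *\<^sub>C (a * b)"
    and star_star: "star (star a) = a"
    and star_add: "star (a + b) = star a + star b"
    and star_scaleC: "star (c *\<^sub>C a) = cnj c *\<^sub>C star a"
    and star_mult: "star (a * b) = star b * star a"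
    and cstar_identity: "norm (star a * a) = norm a ^ 2"

definition alg_invertible :: "'a::unital_cstar_algebra \<Rightarrow> bool" where
  "alg_invertible a \<longleftrightarrow> (\<exists>b. a * b = 1 \<and> b * a = 1)"

definition spectrum :: "'a::unital_cstar_algebra \<Rightarrow> complex set" where
  "spectrum a = {c. \<not> alg_invertible (c *\<^sub>C 1 - a)}"

definition positive :: "'a::unital_cstar_algebra \<Rightarrow> bool" where
  "positive a \<longleftrightarrow> star a = a \<and> spectrum a \<subseteq> {complex_of_real r | r. r \<ge> 0}"

definition cstar_le :: "'a::unital_cstar_algebra \<Rightarrow> 'a \<Rightarrow> bool"  (infix "\<preceq>" 50) where
  "a \<preceq> b \<longleftrightarrow> positive (b - a)"

definition pos_sqrt :: "'a::unital_cstar_algebra \<Rightarrow> 'a" where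
  "pos_sqrt a = (THE b. positive b \<and> b ^ 2 = a)"

definition linear_form :: "('a::unital_cstar_algebra \<Rightarrow> complex) \<Rightarrow> bool" where
  "linear_form \<phi> \<longleftrightarrow> (\<forall>a b. \<phi> (a + b) = \<phi> a + \<phi> b) \<and> (\<forall>c a. \<phi> (c *\<^sub>C a) = c * \<phi> a)"

definition positive_form :: "('a::unital_cstar_algebra \<Rightarrow> complex) \<Rightarrow> bool" where
  "positive_form \<phi> \<longleftrightarrow>
     linear_form \<phi> \<and> (\<forall>a. positive a \<longrightarrow> \<phi> a \<in> \<real> \<and> Re (\<phi> a) \<ge> 0)"

definition strictly_positive :: "'a::unital_cstar_algebra \<Rightarrow> bool" where
  "strictly_positive a \<longleftrightarrow>
     (\<forall>\<phi>. positive_form \<phi> \<and> (\<exists>b. \<phi> b \<noteq> 0) \<longrightarrow> \<phi> a \<in> \<real> \<and> Re (\<phi> a) > 0)"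

definition central :: "'a::unital_cstar_algebra \<Rightarrow> bool" where
  "central a \<longleftrightarrow> (\<forall>b. a * b = b * a)"


section \<open>Hilbert modules\<close>

text \<open>In this section \<open>act\<close> is the left action of the algebra on the module and \<open>ip\<close> the
  algebra-valued inner product.\<close>

definition modulus :: "('h \<Rightarrow> 'h \<Rightarrow> 'a::unital_cstar_algebra) \<Rightarrow> 'h \<Rightarrow> 'a" where
  "modulus ip x = pos_sqrt (ip x x)"

text \<open>The norm of the module is the norm of its type; \<open>norm_eq\<close> identifies it with the norm
  \<open>norm (modulus ip x)\<close> given by the inner product. Completeness of the module for this norm is
  part of the type class \<open>complex_banach\<close>.\<close>

locale hilbert_module =
  fixes act :: "'a::unital_cstar_algebra \<Rightarrow> 'h::complex_banach \<Rightarrow> 'h"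
    and ip :: "'h \<Rightarrow> 'h \<Rightarrow> 'a"
  assumes act_add_right: "act a (x + y) = act a x + act a y"
    and act_add_left: "act (a + b) x = act a x + act b x"
    and act_mult: "act (a * b) x = act a (act b x)"
    and act_one: "act 1 x = x"
    and act_scaleC_left: "act (c *\<^sub>C a) x = c *\<^sub>C act a x"
    and act_scaleC_right: "act a (c *\<^sub>C x) = c *\<^sub>C act a x"
    and ip_add_left: "ip (x + y) z = ip x z + ip y z"
    and ip_act_left: "ip (act a x) y = a * ip x y"
    and ip_star: "star (ip x y) = ip y x"
    and ip_positive: "positive (ip x x)"
    and ip_definite: "ip x x = 0 \<Longrightarrow> x = 0"
    and norm_eq: "norm x = norm (modulus ip x)"

definition submodule :: "('a::unital_cstar_algebra \<Rightarrow> 'h::complex_banach \<Rightarrow> 'h) \<Rightarrow> 'h set \<Rightarrow> bool"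
  where "submodule act K \<longleftrightarrow>
    0 \<in> K \<and> (\<forall>x\<in>K. \<forall>y\<in>K. x + y \<in> K) \<and> (\<forall>a. \<forall>x\<in>K. act a x \<in> K)"

definition orth_complement :: "('h \<Rightarrow> 'h \<Rightarrow> 'a::unital_cstar_algebra) \<Rightarrow> 'h set \<Rightarrow> 'h set" where
  "orth_complement ip K = {u. \<forall>x\<in>K. ip u x = 0}"

definition orth_complemented ::
  "('a::unital_cstar_algebra \<Rightarrow> 'h::complex_banach \<Rightarrow> 'h) \<Rightarrow> ('h \<Rightarrow> 'h \<Rightarrow> 'a) \<Rightarrow> 'h set \<Rightarrow> bool"
  where "orth_complemented act ip K \<longleftrightarrow>
    submodule act K \<and> closed K \<and> K \<inter> orth_complement ip K = {0} \<and>
    (\<forall>x. \<exists>y\<in>K. \<exists>z\<in>orth_complement ip K. x = y + z)"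

definition orth_proj ::
  "('h::complex_banach \<Rightarrow> 'h \<Rightarrow> 'a::unital_cstar_algebra) \<Rightarrow> 'h set \<Rightarrow> 'h \<Rightarrow> 'h"
  where "orth_proj ip K x = (THE y. y \<in> K \<and> x - y \<in> orth_complement ip K)"


section \<open>Weights and *-fusion frames\<close>

text \<open>Sequences are indexed by the positive integers: values at \<open>0\<close> are ignored, and a series
  over \<open>n \<ge> 1\<close> is written with \<open>Suc n\<close>.\<close>

definition weight :: "(nat \<Rightarrow> 'a::unital_cstar_algebra) \<Rightarrow> bool" where
  "weight \<omega> \<longleftrightarrow> (\<forall>n\<ge>1. central (\<omega> n) \<and> strictly_positive (\<omega> n))"

definition frame_term ::
  "('h::complex_banach \<Rightarrow> 'h \<Rightarrow> 'a::unital_cstar_algebra) \<Rightarrow> (nat \<Rightarrow> 'h set) \<Rightarrow> (nat \<Rightarrow> 'a)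
    \<Rightarrow> 'h \<Rightarrow> nat \<Rightarrow> 'a"
  where "frame_term ip H \<omega> x n = \<omega> n ^ 2 * modulus ip (orth_proj ip (H n) x) ^ 2"

definition star_fusion_frame ::
  "('a::unital_cstar_algebra \<Rightarrow> 'h::complex_banach \<Rightarrow> 'h) \<Rightarrow> ('h \<Rightarrow> 'h \<Rightarrow> 'a)
    \<Rightarrow> (nat \<Rightarrow> 'h set) \<Rightarrow> (nat \<Rightarrow> 'a) \<Rightarrow> bool"
  where "star_fusion_frame act ip H \<omega> \<longleftrightarrow>
    (\<forall>x. summable (\<lambda>n. frame_term ip H \<omega> x (Suc n))) \<and>
    (\<exists>A B. strictly_positive A \<and> strictly_positive B \<and>
      (\<forall>x. modulus ip (act A x) ^ 2 \<preceq> (\<Sum>n. frame_term ip H \<omega> x (Suc n)) \<and>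
           (\<Sum>n. frame_term ip H \<omega> x (Suc n)) \<preceq> modulus ip (act B x) ^ 2))"

end

theory Submission
  imports Defs
begin

text \<open>Both \<open>F x = \<Sum> \<omega>\<^sub>n\<^sup>2 |P\<^sub>n x|\<^sup>2\<close> and \<open>F x = |x|\<^sup>2\<close> satisfy \<open>F (a x) = a F(x) a\<^sup>*\<close>, the former because
  the projections are module maps and the weights are central. If \<open>F\<close> and \<open>G\<close> are two such
  positive maps with \<open>norm (F x) \<le> r norm (G x)\<close> for all \<open>x\<close>, then evaluating at \<open>a x\<close> with
  \<open>a = (G x + e)\<^sup>-\<^sup>1\<^sup>/\<^sup>2\<close> gives \<open>a F(x) a \<le> r\<close>, that is, \<open>F x \<le> r (G x + e)\<close>; now let \<open>e \<longlongrightarrow> 0\<close>. Hence the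
  norm inequalities imply the frame inequalities with scalar bounds. Conversely, the frame
  inequalities imply the norm inequalities because the norm is monotone on positive elements and
  strictly positive elements are invertible.\<close>

section \<open>Arithmetic in unital C*-algebras\<close>

text \<open>Positivity is defined through the spectrum and strict positivity through linear forms,
  whereas the argument needs norm estimates and inverses. Two bridges supply them. The norm of a
  self-adjoint element is attained on its spectrum, so positivity of a self-adjoint \<open>a\<close>
  becomes the inequality \<open>norm (t *\<^sub>R 1 - a) \<le> t\<close> for
  \<open>t \<ge> norm a\<close>, which behaves well under sums and limits. And a self-adjoint
  element without a positive scalar lower bound has a nonpositive value at some state, so strictly
  positive elements are invertible. The shift by \<open>e\<close> is there because
  \<open>G x\<close> itself may fail to be invertible.\<close>

lemma scaleC_of_real: "complex_of_real r *\<^sub>C x = r *\<^sub>R (x::'a::complex_banach)"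
  by (simp add: scaleR_scaleC)

lemma scaleC_zero_left [simp]: "0 *\<^sub>C (x::'a::complex_banach) = 0"
  using scaleC_of_real[of 0 x] by simp

lemma scaleC_zero_right [simp]: "c *\<^sub>C (0::'a::complex_banach) = 0"
  using norm_scaleC[of c "0::'a"] by simp

lemma scaleC_minus_left [simp]: "(- c) *\<^sub>C (x::'a::complex_banach) = - (c *\<^sub>C x)"
  using scaleC_add_left[of c "- c" x] by (simp add: eq_neg_iff_add_eq_0 add.commute)

lemma scaleC_minus_right [simp]: "c *\<^sub>C (- x::'a::complex_banach) = - (c *\<^sub>C x)"
  using scaleC_add_right[of c x "- x"] by (simp add: eq_neg_iff_add_eq_0 add.commute)

lemma scaleC_diff_left: "(c - d) *\<^sub>C (x::'a::complex_banach) = c *\<^sub>C x - d *\<^sub>C x"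
  using scaleC_add_left[of c "- d" x] by simp

lemma scaleC_diff_right: "c *\<^sub>C (x - y::'a::complex_banach) = c *\<^sub>C x - c *\<^sub>C y"
  using scaleC_add_right[of c x "- y"] by simp

lemmas scaleC_simps = scaleC_add_left scaleC_add_right scaleC_diff_left scaleC_diff_right
  scaleC_scaleC mult_scaleC_left mult_scaleC_right

lemma star_zero [simp]: "star (0::'a::unital_cstar_algebra) = 0"
  using star_add[of "0::'a" 0] by simp

lemma star_minus [simp]: "star (- a) = - star (a::'a::unital_cstar_algebra)"
  using star_add[of a "- a"] by (simp add: eq_neg_iff_add_eq_0 add.commute)

lemma star_diff: "star (a - b) = star a - star (b::'a::unital_cstar_algebra)"
  using star_add[of a "- b"] by simp

lemma star_scaleR: "star (r *\<^sub>R a) = r *\<^sub>R star (a::'a::unital_cstar_algebra)"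
  by (simp add: scaleR_scaleC star_scaleC)

lemma star_one [simp]: "star (1::'a::unital_cstar_algebra) = 1"
  by (metis mult_1_right star_mult star_star)

text \<open>Submultiplicativity turns the C*-identity into
  \<open>norm b \<le> norm (star b)\<close>; applied also to \<open>star a\<close>, it gives
  equality.\<close>

lemma norm_star [simp]: "norm (star a) = norm (a::'a::unital_cstar_algebra)"
proof -
  have le: "norm b \<le> norm (star b)" for b :: 'a
  proof (cases "b = 0")
    case False
    have "norm b * norm b \<le> norm (star b) * norm b"
      using cstar_identity[of b] norm_mult_ineq[of "star b" b] by (simp add: power2_eq_square)
    with False show ?thesis by simp
  qed simp
  show ?thesis using le[of a] le[of "star a"] by (simp add: star_star)
qed

lemma bounded_linear_star: "bounded_linear (star :: 'a \<Rightarrow> 'a::unital_cstar_algebra)"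
  by (rule bounded_linear_intro[where K = 1]) (auto simp: star_add star_scaleR)

lemma norm_self_adjoint_square:
  "star a = a \<Longrightarrow> norm (a * a) = norm (a::'a::unital_cstar_algebra) ^ 2"
  using cstar_identity[of a] by simp

text \<open>By the C*-identity \<open>norm 1\<close> equals its own square, so it is 0 or 1; the
  value 0 occurs in the zero algebra.\<close>

lemma norm_one_le [simp]: "norm (1::'a::unital_cstar_algebra) \<le> 1"
proof -
  have "norm (1::'a) = norm (1::'a) ^ 2" using cstar_identity[of "1::'a"] by simp
  then have "norm (1::'a) * (norm (1::'a) - 1) = 0" by (simp add: power2_eq_square algebra_simps)
  then show ?thesis by auto
qed

lemma norm_scaleR_one_le: "0 \<le> r \<Longrightarrow> norm (r *\<^sub>R (1::'a::unital_cstar_algebra)) \<le> r"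
  by (simp add: mult_left_le)

lemma eq_zero_of_trivial: "(1::'a::unital_cstar_algebra) = 0 \<Longrightarrow> (a::'a) = 0"
  by (metis mult_1_right mult_zero_right)

section \<open>Invertible elements and the spectrum\<close>

lemma alg_invertibleI:
  "a * b = 1 \<Longrightarrow> c * a = 1 \<Longrightarrow> alg_invertible (a::'a::unital_cstar_algebra)"
  unfolding alg_invertible_def by (metis mult.assoc mult_1_left mult_1_right)

lemma alg_invertible_mult:
  assumes "alg_invertible a" "alg_invertible (b::'a::unital_cstar_algebra)"
  shows "alg_invertible (a * b)"
proof -
  obtain a' b' where "a * a' = 1" "a' * a = 1" "b * b' = 1" "b' * b = 1"
    using assms unfolding alg_invertible_def by auto
  then have "(a * b) * (b' * a') = 1" "(b' * a') * (a * b) = 1"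
    by (metis mult.assoc mult_1_left)+
  then show ?thesis by (rule alg_invertibleI)
qed

text \<open>Commutation lets an inverse \<open>c\<close> of the product yield the right inverse
  \<open>b * c\<close> and the left inverse \<open>c * b\<close>. The case \<open>a = b\<close>
  makes square roots of invertible elements invertible.\<close>

lemma alg_invertible_factor:
  assumes "alg_invertible (a * b)" "a * b = b * (a::'a::unital_cstar_algebra)"
  shows "alg_invertible a"
proof -
  obtain c where "a * b * c = 1" "c * (a * b) = 1"
    using assms(1) unfolding alg_invertible_def by auto
  then have "a * (b * c) = 1" "(c * b) * a = 1" using assms(2) by (metis mult.assoc)+
  then show ?thesis by (rule alg_invertibleI)
qed

lemma alg_invertible_scaleC:
  assumes "c \<noteq> 0" shows "alg_invertible (c *\<^sub>C a) \<longleftrightarrow> alg_invertible (a::'a::unital_cstar_algebra)"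
proof -
  have imp: "alg_invertible (d *\<^sub>C b)" if nz: "d \<noteq> 0" and b: "alg_invertible b" for d and b :: 'a
  proof -
    obtain b' where "b * b' = 1" "b' * b = 1" using b unfolding alg_invertible_def by auto
    then have "(d *\<^sub>C b) * ((1 / d) *\<^sub>C b') = 1" "((1 / d) *\<^sub>C b') * (d *\<^sub>C b) = 1"
      using nz by (simp_all add: scaleC_simps scaleC_one)
    then show ?thesis by (rule alg_invertibleI)
  qed
  show ?thesis
    using imp[OF assms, of a] imp[of "1 / c" "c *\<^sub>C a"] assms by (auto simp: scaleC_scaleC scaleC_one)
qed

lemma alg_invertible_scaleR:
  "r \<noteq> 0 \<Longrightarrow> alg_invertible (r *\<^sub>R a) \<longleftrightarrow> alg_invertible (a::'a::unital_cstar_algebra)"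
  by (metis alg_invertible_scaleC of_real_eq_0_iff scaleC_of_real)

text \<open>The Neumann series is the inverse.\<close>

lemma alg_invertible_one_minus:
  fixes x :: "'a::unital_cstar_algebra"
  assumes "norm x < 1" shows "alg_invertible (1 - x)"
proof -
  have le: "norm (x ^ n) \<le> norm x ^ n" for n
  proof (induction n)
    case (Suc n)
    have "norm (x ^ Suc n) \<le> norm x * norm (x ^ n)" by (simp add: norm_mult_ineq)
    also have "\<dots> \<le> norm x ^ Suc n" using Suc by (simp add: mult_left_mono)
    finally show ?case .
  qed simp
  have sm: "summable (\<lambda>n. x ^ n)"
    by (rule summable_comparison_test'[where g = "\<lambda>n. norm x ^ n" and N = 0])
       (use assms le in \<open>auto intro: summable_geometric\<close>)
  define s where "s = (\<Sum>n. x ^ n)"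
  have split: "s = (\<Sum>n. x ^ Suc n) + 1"
    unfolding s_def using suminf_split_head[OF sm] by simp
  have "x * s = (\<Sum>n. x ^ Suc n)"
    unfolding s_def using bounded_linear.suminf[OF bounded_linear_mult_right sm] by simp
  moreover have "s * x = (\<Sum>n. x ^ Suc n)"
    unfolding s_def using bounded_linear.suminf[OF bounded_linear_mult_left sm]
    by (simp add: power_commutes)
  ultimately have "(1 - x) * s = 1" "s * (1 - x) = 1"
    using split by (simp_all add: algebra_simps)
  then show ?thesis by (rule alg_invertibleI)
qed

lemma cmod_spectrum_le:
  assumes "c \<in> spectrum (a::'a::unital_cstar_algebra)" shows "cmod c \<le> norm a"
proof (rule ccontr)
  assume less: "\<not> cmod c \<le> norm a"
  then have c: "c \<noteq> 0" by auto
  have "norm ((1 / c) *\<^sub>C a) < 1" using less c by (simp add: norm_scaleC norm_divide field_simps)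
  then have "alg_invertible (1 - (1 / c) *\<^sub>C a)" by (rule alg_invertible_one_minus)
  then have "alg_invertible (c *\<^sub>C (1 - (1 / c) *\<^sub>C a))" using alg_invertible_scaleC[OF c] by blast
  also have "c *\<^sub>C (1 - (1 / c) *\<^sub>C a) = c *\<^sub>C 1 - a" using c by (simp add: scaleC_simps scaleC_one)
  finally show False using assms unfolding spectrum_def by simp
qed

lemma spectrum_shift:
  "c \<in> spectrum (d *\<^sub>C 1 + a) \<longleftrightarrow> c - d \<in> spectrum (a::'a::unital_cstar_algebra)"
  unfolding spectrum_def by (simp add: scaleC_diff_left algebra_simps)

lemma spectrum_uminus: "c \<in> spectrum (- a) \<longleftrightarrow> - c \<in> spectrum (a::'a::unital_cstar_algebra)"
  using alg_invertible_scaleC[of "-1" "c *\<^sub>C 1 + a"] unfolding spectrum_def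
  by (simp add: scaleC_simps scaleC_one)

lemma spectrum_scaleR_shift:
  "c \<in> spectrum (r *\<^sub>R 1 + a) \<longleftrightarrow> c - of_real r \<in> spectrum (a::'a::unital_cstar_algebra)"
  using spectrum_shift[of c "of_real r" a] by (simp add: scaleC_of_real)

lemma spectrum_scaleR_reflect:
  "c \<in> spectrum (r *\<^sub>R 1 - a) \<longleftrightarrow> of_real r - c \<in> spectrum (a::'a::unital_cstar_algebra)"
  using spectrum_scaleR_shift[of c r "- a"] spectrum_uminus[of "c - of_real r" a] by simp

text \<open>Shifting by \<open>i t\<close> moves a spectral value \<open>\<alpha> + i \<beta>\<close> out of the disc of radius
  \<open>norm (a + i t)\<close> for suitable large \<open>t\<close>, unless \<open>\<beta> = 0\<close>.\<close>

lemma spectrum_self_adjoint_real: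
  assumes sa: "star a = a" and c: "c \<in> spectrum (a::'a::unital_cstar_algebra)"
  shows "Im c = 0"
proof (rule ccontr)
  assume im: "Im c \<noteq> 0"
  \<comment> \<open>Chosen so that the cross term \<open>2 * Im c * t\<close> of
    \<open>(Im c + t) ^ 2\<close> exceeds \<open>norm a ^ 2\<close> by 1.\<close>
  define t where "t = (norm a ^ 2 + 1) / (2 * Im c)"
  define w where "w = (\<i> * of_real t) *\<^sub>C 1 + a"
  have "c + \<i> * of_real t \<in> spectrum w"
    unfolding w_def using c by (simp add: spectrum_shift)
  then have "cmod (c + \<i> * of_real t) ^ 2 \<le> norm w ^ 2"
    by (intro power_mono cmod_spectrum_le) auto
  also have "norm w ^ 2 = norm ((t ^ 2) *\<^sub>R 1 + a * a)"
  proof -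
    have "\<i> * of_real t * (\<i> * of_real t) = - (of_real t * of_real t)"
      by (simp add: complex_eq_iff)
    then have "star w * w = (t ^ 2) *\<^sub>R 1 + a * a"
      unfolding w_def by (simp add: star_add star_scaleC sa scaleC_simps ring_distribs
          power2_eq_square flip: scaleC_of_real)
    then show ?thesis using cstar_identity[of w] by simp
  qed
  also have "\<dots> \<le> t ^ 2 + norm a ^ 2"
    using norm_scaleR_one_le[of "t ^ 2"] norm_self_adjoint_square[OF sa]
    by (intro norm_triangle_le add_mono) simp_all
  finally have "(Re c) ^ 2 + (Im c + t) ^ 2 \<le> t ^ 2 + norm a ^ 2" by (simp add: cmod_power2)
  moreover have "2 * Im c * t = norm a ^ 2 + 1" unfolding t_def using im by simp
  ultimately have "(Re c) ^ 2 + (Im c) ^ 2 + 1 \<le> 0" by (simp add: power2_eq_square algebra_simps)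
  then show False using sum_power2_ge_zero[of "Re c" "Im c"] by linarith
qed

section \<open>Spectral radius of self-adjoint elements\<close>

lemma inverse_one_minus_square:
  fixes a :: "'a::unital_cstar_algebra"
  assumes p: "(1 - w *\<^sub>C a) * x = 1" "x * (1 - w *\<^sub>C a) = 1"
    and m: "(1 - (- w) *\<^sub>C a) * y = 1" "y * (1 - (- w) *\<^sub>C a) = 1"
  shows "(1 - (w * w) *\<^sub>C (a * a)) * ((1 / 2) *\<^sub>R (x + y)) = 1"
    and "((1 / 2) *\<^sub>R (x + y)) * (1 - (w * w) *\<^sub>C (a * a)) = 1"
proof -
  \<comment> \<open>The identity is the partial fraction decomposition of
    \<open>2 / (1 - b * b)\<close> into \<open>1 / (1 - b)\<close> and
    \<open>1 / (1 + b)\<close>.\<close>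
  define b where "b = w *\<^sub>C a"
  have sq: "(w * w) *\<^sub>C (a * a) = b * b" unfolding b_def by (simp add: scaleC_simps)
  have f: "1 - b * b = (1 + b) * (1 - b)" "1 - b * b = (1 - b) * (1 + b)" by (simp_all add: algebra_simps)
  have e: "(1 - b) * x = 1" "x * (1 - b) = 1" "(1 + b) * y = 1" "y * (1 + b) = 1"
    using p m unfolding b_def by simp_all
  have "(1 - b * b) * x = 1 + b" "(1 - b * b) * y = 1 - b"
    using f e by (metis mult.assoc mult_1_right)+
  then have "(1 - b * b) * (x + y) = 2 *\<^sub>R 1" by (simp add: distrib_left scaleR_2)
  moreover have "x * (1 - b * b) = 1 + b" "y * (1 - b * b) = 1 - b"
    using f e by (metis mult.assoc mult_1_left)+
  then have "(x + y) * (1 - b * b) = 2 *\<^sub>R 1" by (simp add: distrib_right scaleR_2)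
  ultimately show "(1 - (w * w) *\<^sub>C (a * a)) * ((1 / 2) *\<^sub>R (x + y)) = 1"
    "((1 / 2) *\<^sub>R (x + y)) * (1 - (w * w) *\<^sub>C (a * a)) = 1"
    unfolding sq by simp_all
qed

text \<open>The resolvent identity writes \<open>f u - f v\<close> as \<open>u - v\<close> times
  \<open>f u * (a * f v)\<close>. This still contains \<open>f u\<close>, for which no bound is
  assumed.\<close>

lemma continuous_on_resolvent:
  fixes f :: "complex \<Rightarrow> 'a::unital_cstar_algebra"
  assumes "\<And>u. u \<in> S \<Longrightarrow> (1 - u *\<^sub>C a) * f u = 1" "\<And>u. u \<in> S \<Longrightarrow> f u * (1 - u *\<^sub>C a) = 1"
  shows "continuous_on S f"
  unfolding continuous_on_def
proof
  fix v assume v: "v \<in> S"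
  define K where "K = norm a * norm (f v)"
  have K: "0 \<le> K" unfolding K_def by simp
  have diff: "norm (f u - f v) \<le> cmod (u - v) * (norm (f u) * K)" if "u \<in> S" for u
  proof -
    have "f u - f v = f u * ((1 - v *\<^sub>C a) * f v) - (f u * (1 - u *\<^sub>C a)) * f v"
      using assms[OF that] assms[OF v] by simp
    also have "\<dots> = f u * ((1 - v *\<^sub>C a) - (1 - u *\<^sub>C a)) * f v"
      by (simp only: right_diff_distrib left_diff_distrib mult.assoc)
    also have "\<dots> = (u - v) *\<^sub>C (f u * (a * f v))"
      by (simp add: scaleC_simps algebra_simps)
    finally have "norm (f u - f v) = cmod (u - v) * norm (f u * (a * f v))" by (simp add: norm_scaleC)
    also have "norm (f u * (a * f v)) \<le> norm (f u) * K"
      unfolding K_def by (meson mult_left_mono norm_ge_zero norm_mult_ineq order_trans)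
    finally show ?thesis by (simp add: mult_left_mono)
  qed
  \<comment> \<open>Close to \<open>v\<close> the identity bounds \<open>norm (f u)\<close> by
    \<open>norm (f v)\<close> plus half of itself, hence by \<open>2 * norm (f v)\<close>.\<close>
  have bnd: "norm (f u - f v) \<le> cmod (u - v) * (2 * norm (f v) * K)"
    if u: "u \<in> S" and small: "cmod (u - v) * K \<le> 1 / 2" for u
  proof -
    have "norm (f u) \<le> norm (f v) + norm (f u - f v)" by (rule norm_triangle_sub)
    also have "\<dots> \<le> norm (f v) + norm (f u) * (cmod (u - v) * K)"
      using diff[OF u] by (simp add: mult_ac)
    also have "\<dots> \<le> norm (f v) + norm (f u) * (1 / 2)" by (intro add_left_mono mult_left_mono small) auto
    finally have "norm (f u) \<le> 2 * norm (f v)" by simp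
    then have "cmod (u - v) * (norm (f u) * K) \<le> cmod (u - v) * (2 * norm (f v) * K)"
      using K by (intro mult_left_mono mult_right_mono) auto
    then show ?thesis using diff[OF u] by linarith
  qed
  have lim: "((\<lambda>u. cmod (u - v) * C) \<longlongrightarrow> 0) (at v within S)" for C
  proof -
    have "((\<lambda>u. cmod (u - v) * C) \<longlongrightarrow> cmod (v - v) * C) (at v within S)" by (intro tendsto_intros)
    then show ?thesis by simp
  qed
  have "\<forall>\<^sub>F u in at v within S. cmod (u - v) * K < 1 / 2"
    using order_tendstoD(2)[OF lim, of "1 / 2" K] by simp
  moreover have "\<forall>\<^sub>F u in at v within S. u \<in> S" by (simp add: eventually_at_filter)
  ultimately have "\<forall>\<^sub>F u in at v within S. norm (f u - f v) \<le> cmod (u - v) * (2 * norm (f v) * K)"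
    by eventually_elim (auto intro: bnd)
  then have "((\<lambda>u. f u - f v) \<longlongrightarrow> 0) (at v within S)"
    by (rule Lim_null_comparison) (rule lim)
  then show "(f \<longlongrightarrow> f v) (at v within S)" by (simp add: LIM_zero_iff)
qed

text \<open>If \<open>(1 - u a)\<^sup>-\<^sup>1\<close> existed on the whole closed unit disc, it would be uniformly continuous
  there. Averaging over \<open>\<plusminus>u\<close> turns the inverse of \<open>1 - u a\<close> into that of \<open>1 - u\<^sup>2 a\<^sup>2\<close> without
  enlarging the modulus of continuity, so the inverses of \<open>1 - a ^ (2 ^ k)\<close> and of
  \<open>1 - s ^ (2 ^ k) a ^ (2 ^ k)\<close> stay close for some fixed \<open>s < 1\<close>. The latter tends to \<open>1\<close>,
  against \<open>norm (a ^ (2 ^ k)) = 1\<close>. This is Rickart's proof of the spectral radius formula, which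
  avoids Liouville's theorem.\<close>

lemma self_adjoint_unit_disc_not_resolvent:
  fixes a :: "'a::unital_cstar_algebra"
  assumes sa: "star a = a" and n1: "norm a = 1"
  shows "\<exists>u. cmod u \<le> 1 \<and> \<not> alg_invertible (1 - u *\<^sub>C a)"
proof (rule ccontr)
  assume "\<not> ?thesis"
  then have "\<forall>u\<in>cball 0 1. \<exists>z. (1 - u *\<^sub>C a) * z = 1 \<and> z * (1 - u *\<^sub>C a) = 1"
    unfolding alg_invertible_def by auto
  then obtain f where f: "(1 - u *\<^sub>C a) * f u = 1" "f u * (1 - u *\<^sub>C a) = 1"
    if "u \<in> cball 0 1" for u by metis
  have "continuous_on (cball 0 1) f" by (rule continuous_on_resolvent) (use f in auto)
  then have "uniformly_continuous_on (cball 0 1) f"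
    by (rule compact_uniformly_continuous) simp
  \<comment> \<open>The tolerance 1/9, with 1/10 for \<open>\<sigma> k\<close> below, leads to
    \<open>norm (A k) \<le> 4 / 9\<close>, which contradicts \<open>norm (A k) = 1\<close>.\<close>
  then obtain \<delta> where \<delta>: "\<delta> > 0"
    "\<And>u v. u \<in> cball 0 1 \<Longrightarrow> v \<in> cball 0 1 \<Longrightarrow> dist v u < \<delta> \<Longrightarrow> dist (f v) (f u) < 1 / 9"
    unfolding uniformly_continuous_on_def by (metis divide_pos_pos zero_less_numeral zero_less_one)
  define s where "s = max 0 (1 - \<delta> / 2)"
  have s: "0 \<le> s" "s < 1" "1 - s < \<delta>" unfolding s_def using \<delta>(1) by auto
  define A where "A k = a ^ (2 ^ k)" for k :: nat
  define \<sigma> where "\<sigma> k = s ^ (2 ^ k)" for k :: nat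
  have A0: "A 0 = a" and ASuc: "A (Suc k) = A k * A k" for k
    unfolding A_def by (simp_all add: power_mult mult.commute[of 2] flip: power2_eq_square)
  have \<sigma>0: "\<sigma> 0 = s" and \<sigma>Suc: "\<sigma> (Suc k) = \<sigma> k * \<sigma> k" for k
    unfolding \<sigma>_def by (simp_all add: power_mult mult.commute[of 2] flip: power2_eq_square)
  have A: "star (A k) = A k \<and> norm (A k) = 1" for k
    by (induction k) (simp_all add: A0 ASuc sa n1 star_mult norm_self_adjoint_square)
  define inv where "inv k w z \<longleftrightarrow> (1 - w *\<^sub>C A k) * z = 1 \<and> z * (1 - w *\<^sub>C A k) = 1" for k w z
  have step: "inv (Suc k) (w * w) ((1 / 2) *\<^sub>R (x + y))" if "inv k w x" "inv k (- w) y" for k w x y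
    using that inverse_one_minus_square[of w "A k" x y] unfolding inv_def ASuc by simp
  \<comment> \<open>Only \<open>u = 1\<close> is used in the end, but stage \<open>Suc k\<close> at
    \<open>u\<close> relies on stage \<open>k\<close> at both square roots of \<open>u\<close>, so
    the induction needs the whole unit circle.\<close>
  have close: "\<exists>z z'. inv k u z \<and> inv k (of_real (\<sigma> k) * u) z' \<and> norm (z - z') \<le> 1 / 9"
    if "cmod u = 1" for k u
    using that
  proof (induction k arbitrary: u)
    case 0
    have m: "u \<in> cball 0 1" "of_real s * u \<in> cball 0 1" using 0 s by (auto simp: norm_mult)
    have "dist u (of_real s * u) = cmod (of_real (1 - s) * u)"
      by (simp add: dist_norm algebra_simps)
    also have "\<dots> < \<delta>" using 0 s unfolding norm_mult norm_of_real by simp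
    finally have "norm (f u - f (of_real s * u)) < 1 / 9"
      using \<delta>(2)[OF m(2) m(1)] by (simp add: dist_norm)
    then show ?case using f[OF m(1)] f[OF m(2)] unfolding inv_def A0 \<sigma>0 by (meson less_imp_le)
  next
    case (Suc k)
    define v where "v = csqrt u"
    have v: "v * v = u" unfolding v_def by (simp flip: power2_eq_square)
    have "cmod v = 1" unfolding v_def using Suc.prems by (simp add: norm_csqrt)
    then have "cmod v = 1" "cmod (- v) = 1" by simp_all
    from this[THEN Suc.IH] obtain x x' y y' where
      xy: "inv k v x" "inv k (of_real (\<sigma> k) * v) x'" "norm (x - x') \<le> 1 / 9"
      "inv k (- v) y" "inv k (- (of_real (\<sigma> k) * v)) y'" "norm (y - y') \<le> 1 / 9" by auto
    have "inv (Suc k) u ((1 / 2) *\<^sub>R (x + y))" using step[OF xy(1,4)] by (simp add: v)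
    moreover have "inv (Suc k) (of_real (\<sigma> (Suc k)) * u) ((1 / 2) *\<^sub>R (x' + y'))"
      using step[OF xy(2,5)] by (simp add: \<sigma>Suc mult_ac flip: v)
    moreover have "norm ((1 / 2) *\<^sub>R (x + y) - (1 / 2) *\<^sub>R (x' + y')) \<le> 1 / 9"
    proof -
      have "(1 / 2) *\<^sub>R (x + y) - (1 / 2) *\<^sub>R (x' + y') = (1 / 2) *\<^sub>R ((x - x') + (y - y'))"
        by (simp add: algebra_simps)
      then show ?thesis using norm_triangle_ineq[of "x - x'" "y - y'"] xy by simp
    qed
    ultimately show ?case by blast
  qed
  obtain k where k: "s ^ k < 1 / 10" using real_arch_pow_inv[of "1 / 10" s] s by auto
  have "\<sigma> k \<le> s ^ k" unfolding \<sigma>_def using s by (intro power_decreasing) (auto intro: less_imp_le)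
  with k have \<sigma>: "0 \<le> \<sigma> k" "\<sigma> k \<le> 1 / 10" using s unfolding \<sigma>_def by auto
  obtain z z' where z: "inv k 1 z" "inv k (of_real (\<sigma> k)) z'" "norm (z - z') \<le> 1 / 9"
    using close[of 1 k] by auto
  have "z' - 1 = \<sigma> k *\<^sub>R (A k * z')"
    using z(2) unfolding inv_def by (simp add: left_diff_distrib scaleC_of_real algebra_simps)
  then have "norm (z' - 1) = \<sigma> k * norm (A k * z')" using \<sigma> by simp
  also have "\<dots> \<le> 1 / 10 * norm z'"
    using norm_mult_ineq[of "A k" z'] A[of k] \<sigma> by (intro mult_mono) auto
  finally have 1: "norm (z' - 1) \<le> norm z' / 10" by simp
  have "norm z' \<le> norm (z' - 1) + 1"
    using norm_triangle_sub[of z' 1] norm_one_le[where ?'a = 'a] by linarith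
  with 1 have 2: "norm (z' - 1) \<le> 1 / 9" by linarith
  have "norm (z - 1) \<le> norm (z - z') + norm (z' - 1)"
    using norm_triangle_ineq[of "z - z'" "z' - 1"] by simp
  with 2 z(3) have 3: "norm (z - 1) \<le> 2 / 9" by linarith
  have zA: "z * (1 - A k) = 1" using z(1) unfolding inv_def by (simp add: scaleC_one)
  \<comment> \<open>As \<open>z\<close> inverts \<open>1 - A k\<close>, subtracting
    \<open>1 - A k\<close> from \<open>z * (1 - A k) = 1\<close> leaves \<open>A k\<close>; this
    bounds \<open>A k\<close> by the distance from \<open>z\<close> to 1.\<close>
  have "A k = (z - 1) * (1 - A k)" by (simp add: left_diff_distrib zA)
  also have "\<dots> = (z - 1) - (z - 1) * A k" by (simp add: right_diff_distrib)
  finally have "norm (A k) \<le> norm (z - 1) + norm ((z - 1) * A k)" by (metis norm_triangle_ineq4)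
  also have "\<dots> \<le> 2 / 9 + 2 / 9"
    using norm_mult_ineq[of "z - 1" "A k"] A[of k] 3 by simp
  finally show False using A[of k] by simp
qed

text \<open>After normalization, a singular point \<open>u\<close> of the closed unit disc gives the
  spectral value \<open>r / u\<close>. Its modulus is at least \<open>r\<close> because
  \<open>cmod u \<le> 1\<close>, and no spectral value exceeds the norm.\<close>

lemma self_adjoint_norm_attained:
  fixes a :: "'a::unital_cstar_algebra"
  assumes sa: "star a = a" and "a \<noteq> 0"
  obtains c where "c \<in> spectrum a" "cmod c = norm a"
proof -
  define r where "r = norm a"
  have r: "r > 0" unfolding r_def using assms by simp
  have "star ((1 / r) *\<^sub>R a) = (1 / r) *\<^sub>R a" "norm ((1 / r) *\<^sub>R a) = 1"
    using sa r by (simp_all add: star_scaleR) (simp add: r_def)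
  then obtain u where u: "cmod u \<le> 1" "\<not> alg_invertible (1 - u *\<^sub>C (1 / r) *\<^sub>R a)"
    using self_adjoint_unit_disc_not_resolvent by blast
  have u0: "u \<noteq> 0" using u(2) alg_invertible_one_minus[of 0] by auto
  have "1 - u *\<^sub>C (1 / r) *\<^sub>R a = (u / of_real r) *\<^sub>C ((of_real r / u) *\<^sub>C 1 - a)"
    using u0 r by (simp add: scaleC_simps scaleR_scaleC scaleC_one)
  then have c: "of_real r / u \<in> spectrum a"
    using u(2) alg_invertible_scaleC[of "u / of_real r" "(of_real r / u) *\<^sub>C 1 - a"] u0 r
    unfolding spectrum_def by simp
  moreover have "r \<le> cmod (of_real r / u)"
    using u u0 r by (simp add: norm_divide field_simps)
  ultimately show ?thesis using that cmod_spectrum_le[OF c] unfolding r_def by force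
qed

lemma self_adjoint_norm_le:
  fixes a :: "'a::unital_cstar_algebra"
  assumes "star a = a" "0 \<le> r" "\<And>c. c \<in> spectrum a \<Longrightarrow> cmod c \<le> r"
  shows "norm a \<le> r"
  using assms self_adjoint_norm_attained[of a] by (cases "a = 0") (simp, metis)

section \<open>The positive cone\<close>

lemma positive_self_adjoint: "positive a \<Longrightarrow> star a = a"
  by (simp add: positive_def)

lemma positive_spectrum_nonneg: "positive a \<Longrightarrow> of_real r \<in> spectrum a \<Longrightarrow> 0 \<le> r"
  unfolding positive_def by auto

lemma positiveI_spectrum:
  assumes "star a = a" "\<And>r. of_real r \<in> spectrum a \<Longrightarrow> 0 \<le> r"
  shows "positive a"
proof -
  have "\<exists>r. c = of_real r \<and> 0 \<le> r" if c: "c \<in> spectrum a" for c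
  proof -
    have "c = of_real (Re c)"
      using spectrum_self_adjoint_real[OF assms(1) c] by (simp add: complex_eq_iff)
    then show ?thesis using c assms(2) by metis
  qed
  then show ?thesis using assms(1) unfolding positive_def by auto
qed

text \<open>The spectrum lies in the disc of radius \<open>t\<close> about \<open>t\<close>, which
  contains no negative reals. With the converse \<open>positive_norm_le\<close> this replaces
  positivity by a closed norm condition.\<close>

lemma positiveI_norm:
  assumes "star a = a" "norm (t *\<^sub>R 1 - a) \<le> t"
  shows "positive a"
proof (rule positiveI_spectrum)
  fix r assume "of_real r \<in> spectrum a"
  then have "of_real (t - r) \<in> spectrum (t *\<^sub>R 1 - a)" by (simp add: spectrum_scaleR_reflect)
  then have "cmod (of_real (t - r)) \<le> t" using cmod_spectrum_le assms(2) by (metis order_trans)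
  then show "0 \<le> r" unfolding norm_of_real by linarith
qed fact

text \<open>The spectrum of \<open>a\<close> lies in the interval from 0 to \<open>t\<close>, and so
  does its reflection; the spectral radius formula turns this into a norm bound.\<close>

lemma positive_norm_le:
  assumes "positive a" "norm a \<le> t"
  shows "norm (t *\<^sub>R 1 - a) \<le> t"
proof (rule self_adjoint_norm_le)
  show "star (t *\<^sub>R 1 - a) = t *\<^sub>R 1 - a"
    using assms by (simp add: star_diff star_scaleR positive_self_adjoint)
  show "0 \<le> t" using assms(2) norm_ge_zero order_trans by blast
  fix c assume "c \<in> spectrum (t *\<^sub>R 1 - a)"
  then have c: "of_real t - c \<in> spectrum a" by (simp add: spectrum_scaleR_reflect)
  then obtain r where r: "of_real t - c = of_real r" "0 \<le> r" using assms(1) unfolding positive_def by auto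
  then have "r \<le> t" using cmod_spectrum_le[OF c] assms(2) by simp
  moreover have "c = of_real (t - r)" using r(1) by (simp add: algebra_simps)
  ultimately show "cmod c \<le> t" using r(2) by (simp only: norm_of_real)
qed

text \<open>The norm criterion with \<open>t = norm a + norm b\<close> reduces this to the triangle
  inequality.\<close>

lemma positive_add: "positive a \<Longrightarrow> positive b \<Longrightarrow> positive (a + b)"
proof (rule positiveI_norm)
  assume ab: "positive a" "positive b"
  then show "star (a + b) = a + b" by (simp add: star_add positive_self_adjoint)
  have "(norm a + norm b) *\<^sub>R 1 - (a + b) = (norm a *\<^sub>R 1 - a) + (norm b *\<^sub>R 1 - b)"
    by (simp add: scaleR_add_left)
  then show "norm ((norm a + norm b) *\<^sub>R 1 - (a + b)) \<le> norm a + norm b"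
    using positive_norm_le[OF ab(1) order_refl] positive_norm_le[OF ab(2) order_refl]
    by (metis norm_triangle_le add_mono)
qed

lemma positive_scaleR:
  assumes "positive a" "0 \<le> r" shows "positive (r *\<^sub>R a)"
proof (rule positiveI_norm)
  show "star (r *\<^sub>R a) = r *\<^sub>R a" using assms by (simp add: star_scaleR positive_self_adjoint)
  have "(r * norm a) *\<^sub>R 1 - r *\<^sub>R a = r *\<^sub>R (norm a *\<^sub>R 1 - a)" by (simp add: algebra_simps)
  then have "norm ((r * norm a) *\<^sub>R 1 - r *\<^sub>R a) = r * norm (norm a *\<^sub>R 1 - a)"
    using assms(2) by simp
  then show "norm ((r * norm a) *\<^sub>R 1 - r *\<^sub>R a) \<le> r * norm a"
    using positive_norm_le[OF assms(1) order_refl] assms(2) by (simp add: mult_left_mono)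
qed

lemma positive_scaleR_one: "0 \<le> r \<Longrightarrow> positive (r *\<^sub>R 1)"
  by (rule positiveI_norm[where t = r]) (simp_all add: star_scaleR)

lemma positive_zero: "positive 0"
  using positive_scaleR_one[of 0] by simp

lemma positive_sum: "(\<And>i. i \<in> I \<Longrightarrow> positive (f i)) \<Longrightarrow> positive (sum f I)"
  by (induction I rule: infinite_finite_induct) (auto intro: positive_zero positive_add)

text \<open>A convergent sequence is bounded, so one \<open>t\<close> serves the norm criterion for
  all its terms and the inequality passes to the limit.\<close>

lemma positive_limit:
  assumes lim: "X \<longlonglongrightarrow> a" and pos: "\<And>n. positive (X n)"
  shows "positive a"
proof -
  have "(\<lambda>n. star (X n)) \<longlonglongrightarrow> star a"
    by (rule bounded_linear.tendsto[OF bounded_linear_star lim])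
  then have "X \<longlonglongrightarrow> star a" by (simp only: positive_self_adjoint[OF pos])
  then have sa: "star a = a" using lim by (rule LIMSEQ_unique)
  obtain t where t: "norm (X n) \<le> t" for n
    using convergent_imp_Bseq[OF convergentI[OF lim]] unfolding Bseq_def by auto
  have "norm (t *\<^sub>R 1 - a) \<le> t"
    by (rule LIMSEQ_le_const2[where X = "\<lambda>n. norm (t *\<^sub>R 1 - X n)"])
       (use positive_norm_le[OF pos t] in \<open>auto intro!: tendsto_intros lim\<close>)
  with sa show ?thesis by (rule positiveI_norm)
qed

lemma positive_suminf: "summable f \<Longrightarrow> (\<And>n. positive (f n)) \<Longrightarrow> positive (suminf f)"
  using positive_limit[of "\<lambda>n. sum f {..<n}"] by (simp add: positive_sum summable_LIMSEQ)

lemma positive_if_positive_plus_small: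
  assumes "\<And>e. 0 < e \<Longrightarrow> positive (a + e *\<^sub>R b)"
  shows "positive a"
proof (rule positive_limit)
  have "(\<lambda>n. a + inverse (real (Suc n)) *\<^sub>R b) \<longlonglongrightarrow> a + 0 *\<^sub>R b"
    by (intro tendsto_intros LIMSEQ_inverse_real_of_nat)
  then show "(\<lambda>n. a + inverse (real (Suc n)) *\<^sub>R b) \<longlonglongrightarrow> a" by simp
qed (use assms in simp)

text \<open>A nonzero \<open>a\<close> would have a spectral value of modulus \<open>norm a\<close>,
  but the hypotheses force that value to be both nonnegative and nonpositive.\<close>

lemma positive_antisym:
  assumes "positive a" "positive (- a)" shows "a = 0"
proof (rule ccontr)
  assume "a \<noteq> 0"
  then obtain c where c: "c \<in> spectrum a" "cmod c = norm a"
    using self_adjoint_norm_attained positive_self_adjoint[OF assms(1)] by blast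
  have "- c \<in> spectrum (- a)" using c(1) by (simp add: spectrum_uminus)
  then obtain r where r: "- c = of_real r" "0 \<le> r" using assms(2) unfolding positive_def by auto
  then have "c = of_real (- r)" by (metis minus_minus of_real_minus)
  then have "- r \<ge> 0" using positive_spectrum_nonneg[OF assms(1)] c(1) by metis
  then show False using r c \<open>a \<noteq> 0\<close> by simp
qed

lemma positive_norm_minus:
  assumes "star a = a" shows "positive (norm a *\<^sub>R 1 - a)"
proof (rule positiveI_spectrum)
  show "star (norm a *\<^sub>R 1 - a) = norm a *\<^sub>R 1 - a" using assms by (simp add: star_diff star_scaleR)
  fix r assume "of_real r \<in> spectrum (norm a *\<^sub>R 1 - a)"
  then have "of_real (norm a - r) \<in> spectrum a" by (simp add: spectrum_scaleR_reflect)
  then have "cmod (of_real (norm a - r)) \<le> norm a" by (rule cmod_spectrum_le)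
  then show "0 \<le> r" unfolding norm_of_real by linarith
qed

lemma positive_norm_plus: "star a = a \<Longrightarrow> positive (norm a *\<^sub>R 1 + a)"
  using positive_norm_minus[of "- a"] by simp

lemma norm_le_if_positive_diff:
  assumes "positive a" "positive (r *\<^sub>R 1 - a)" "0 \<le> r" shows "norm a \<le> r"
proof (rule self_adjoint_norm_le)
  fix c assume c: "c \<in> spectrum a"
  then obtain s where s: "c = of_real s" "0 \<le> s" using assms(1) unfolding positive_def by auto
  have "of_real (r - s) \<in> spectrum (r *\<^sub>R 1 - a)"
    using c s(1) by (simp add: spectrum_scaleR_reflect)
  then have "0 \<le> r - s" by (rule positive_spectrum_nonneg[OF assms(2)])
  then show "cmod c \<le> r" using s by simp
qed (use assms positive_self_adjoint in auto)

lemma positive_norm_mono: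
  assumes "positive a" "positive (b - a)" shows "norm a \<le> norm b"
proof (rule norm_le_if_positive_diff[OF assms(1)])
  have "star b = b"
    using positive_self_adjoint[OF positive_add[OF assms]] by simp
  then show "positive (norm b *\<^sub>R 1 - a)"
    using positive_add[OF positive_norm_minus assms(2), of b] by simp
qed simp

text \<open>For \<open>r < 0\<close> take an imaginary \<open>s\<close> with
  \<open>s * s = r\<close>. Then \<open>r - h * h\<close> factors as
  \<open>(s - h) * (s + h)\<close>, and both factors are invertible because \<open>h\<close> has
  real spectrum.\<close>

lemma positive_square:
  assumes "star h = h" shows "positive (h * h)"
proof (rule positiveI_spectrum)
  show "star (h * h) = h * h" using assms by (simp add: star_mult)
  fix r :: real assume r: "of_real r \<in> spectrum (h * h)"
  show "0 \<le> r"
  proof (rule ccontr)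
    assume "\<not> 0 \<le> r"
    define s where "s = \<i> * of_real (sqrt (- r))"
    have im: "Im s \<noteq> 0" "Im (- s) \<noteq> 0" unfolding s_def using \<open>\<not> 0 \<le> r\<close> by auto
    have ss: "s * s = of_real r"
    proof -
      have "s * s = - of_real (sqrt (- r) * sqrt (- r))" unfolding s_def by (simp add: complex_eq_iff)
      also have "sqrt (- r) * sqrt (- r) = - r" using \<open>\<not> 0 \<le> r\<close> by simp
      finally show ?thesis by simp
    qed
    have "alg_invertible (s *\<^sub>C 1 - h)" "alg_invertible ((- s) *\<^sub>C 1 - h)"
      using im spectrum_self_adjoint_real[OF assms] unfolding spectrum_def by blast+
    then have "alg_invertible ((s *\<^sub>C 1 - h) * ((-1) *\<^sub>C ((- s) *\<^sub>C 1 - h)))"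
      by (intro alg_invertible_mult) (simp_all only: alg_invertible_scaleC[of "-1"] neg_equal_0_iff_equal one_neq_zero not_False_eq_True)
    also have "(s *\<^sub>C 1 - h) * ((-1) *\<^sub>C ((- s) *\<^sub>C 1 - h)) = of_real r *\<^sub>C 1 - h * h"
      by (simp add: scaleC_simps scaleC_one algebra_simps flip: ss)
    finally show False using r unfolding spectrum_def by simp
  qed
qed

lemma positive_add_scaleR_one_invertible:
  assumes "positive a" "0 < t" shows "alg_invertible (a + t *\<^sub>R 1)"
proof -
  have "of_real (- t) \<notin> spectrum a" using positive_spectrum_nonneg[OF assms(1), of "- t"] assms(2) by auto
  then have "alg_invertible (of_real (- t) *\<^sub>C 1 - a)" unfolding spectrum_def by simp
  also have "of_real (- t) *\<^sub>C 1 - a = (-1) *\<^sub>R (a + t *\<^sub>R 1)"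
    unfolding scaleC_of_real by (simp add: algebra_simps)
  finally show ?thesis using alg_invertible_scaleR[of "-1" "a + t *\<^sub>R 1"] by simp
qed

text \<open>With \<open>k\<close> the inverse, \<open>b - t = b * (1 - t k)\<close> is invertible
  when \<open>t * norm k < 1\<close>, so the spectrum keeps a distance from 0.\<close>

lemma positive_invertible_bounded_below:
  assumes "positive b" "alg_invertible b" obtains d where "0 < d" "positive (b - d *\<^sub>R 1)"
proof -
  obtain k where k: "b * k = 1" "k * b = 1" using assms(2) unfolding alg_invertible_def by auto
  \<comment> \<open>The \<open>+ 1\<close> covers \<open>k = 0\<close>, which happens in the zero
    algebra.\<close>
  define d where "d = 1 / (norm k + 1)"
  have d: "0 < d" "d * norm k < 1" unfolding d_def by (simp_all add: add_nonneg_pos divide_simps)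
  have "positive (- (d *\<^sub>R 1) + b)"
  proof (rule positiveI_spectrum)
    show "star (- (d *\<^sub>R 1) + b) = - (d *\<^sub>R 1) + b"
      using assms(1) by (simp add: star_diff star_scaleR positive_self_adjoint)
    fix r assume "of_real r \<in> spectrum (- (d *\<^sub>R 1) + b)"
    then have r: "of_real (r + d) \<in> spectrum b" using spectrum_scaleR_shift[of "of_real r" "- d" b] by simp
    then have pos: "0 \<le> r + d" using positive_spectrum_nonneg[OF assms(1)] by blast
    show "0 \<le> r"
    proof (rule ccontr)
      assume "\<not> 0 \<le> r"
      then have "norm ((r + d) *\<^sub>R k) \<le> d * norm k" using pos by (simp add: mult_right_mono)
      then have "alg_invertible (1 - (r + d) *\<^sub>R k)" using d(2) by (intro alg_invertible_one_minus) simp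
      then have "alg_invertible ((-1) *\<^sub>R (b * (1 - (r + d) *\<^sub>R k)))"
        using assms(2) alg_invertible_mult alg_invertible_scaleR[of "-1"] by fastforce
      also have "(-1) *\<^sub>R (b * (1 - (r + d) *\<^sub>R k)) = (r + d) *\<^sub>R 1 - b"
        by (simp add: right_diff_distrib k)
      finally show False using r by (simp add: spectrum_def scaleC_of_real del: of_real_add)
    qed
  qed
  then show ?thesis using that d(1) by (metis add.commute diff_conv_add_uminus)
qed

lemma self_adjoint_inverse:
  assumes "star a = a" "a * k = 1" "k * a = (1::'a::unital_cstar_algebra)" shows "star k = k"
proof -
  have "star k * a = 1" using assms star_mult[of a k] by simp
  then show ?thesis using assms(2) by (metis mult.assoc mult_1_left mult_1_right)
qed

text \<open>For \<open>t > 0\<close> the element \<open>a p a + t = a (p + t a\<^sup>-\<^sup>2) a\<close> is invertible, so no negative number is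
  in the spectrum of \<open>a p a\<close>. This avoids the general fact that \<open>x\<^sup>* x\<close> is positive.\<close>

lemma positive_conjugate:
  assumes p: "positive p" and sa: "star a = a" and inv: "alg_invertible a"
  shows "positive (a * p * a)"
proof (rule positiveI_spectrum)
  obtain k where k: "a * k = 1" "k * a = 1" using inv unfolding alg_invertible_def by auto
  then have k_inv: "alg_invertible k" by (metis alg_invertibleI)
  have k_sa: "star k = k" using self_adjoint_inverse[OF sa k] .
  show "star (a * p * a) = a * p * a"
    using sa p by (simp add: star_mult positive_self_adjoint mult.assoc)
  obtain d where d: "0 < d" "positive (k * k - d *\<^sub>R 1)"
    using positive_invertible_bounded_below[OF positive_square[OF k_sa] alg_invertible_mult[OF k_inv k_inv]] .
  fix r assume r: "of_real r \<in> spectrum (a * p * a)"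
  show "0 \<le> r"
  proof (rule ccontr)
    assume neg: "\<not> 0 \<le> r"
    \<comment> \<open>With \<open>t = - r\<close>, the sum \<open>p + t (k * k)\<close> is split
      into a positive element and the scalar \<open>t * d > 0\<close>, hence is invertible.\<close>
    have "positive (p + (- r) *\<^sub>R (k * k - d *\<^sub>R 1))"
      using neg by (intro positive_add p positive_scaleR d) simp
    then have "alg_invertible (p + (- r) *\<^sub>R (k * k - d *\<^sub>R 1) + (- r * d) *\<^sub>R 1)"
      using neg d(1) by (intro positive_add_scaleR_one_invertible) (auto intro: mult_neg_pos)
    also have "p + (- r) *\<^sub>R (k * k - d *\<^sub>R 1) + (- r * d) *\<^sub>R 1 = p + (- r) *\<^sub>R (k * k)"
      by (simp add: algebra_simps)
    finally have "alg_invertible ((-1) *\<^sub>R (a * (p + (- r) *\<^sub>R (k * k)) * a))"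
      using inv alg_invertible_mult alg_invertible_scaleR[of "-1"] by fastforce
    also have "a * (k * k) * a = 1" using k by (metis mult.assoc mult_1_right)
    then have "(-1) *\<^sub>R (a * (p + (- r) *\<^sub>R (k * k)) * a) = r *\<^sub>R 1 - a * p * a"
      by (simp add: distrib_left distrib_right left_diff_distrib right_diff_distrib)
    finally show False using r by (simp add: spectrum_def scaleC_of_real del: of_real_add)
  qed
qed

section \<open>Square roots\<close>

text \<open>Writing \<open>a = 1 - x\<close>, the root is \<open>1 - y\<close> with \<open>y\<close> the limit of \<open>y \<mapsto> (x + y\<^sup>2) / 2\<close> from \<open>0\<close>;
  the scalar iteration \<open>u \<mapsto> (1 + u\<^sup>2) / 2\<close> majorizes the steps.\<close>

lemma sqrt_exists_norm_le_1:
  fixes a :: "'a::unital_cstar_algebra"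
  assumes pos: "positive a" and n1: "norm a \<le> 1"
  shows "\<exists>r. positive r \<and> r * r = a \<and> (\<forall>b. b * a = a * b \<longrightarrow> b * r = r * b)"
proof -
  define x where "x = 1 - a"
  have x: "norm x \<le> 1" unfolding x_def using positive_norm_le[OF pos n1] by simp
  define y where "y = rec_nat 0 (\<lambda>_ v. (1 / 2) *\<^sub>R (x + v * v))"
  define u where "u = rec_nat 0 (\<lambda>_ v. (1 / 2) * (1 + v * v) :: real)"
  have y0: "y 0 = 0" and yS: "y (Suc n) = (1 / 2) *\<^sub>R (x + y n * y n)" for n unfolding y_def by simp_all
  have u0: "u 0 = 0" and uS: "u (Suc n) = (1 / 2) * (1 + u n * u n)" for n unfolding u_def by simp_all
  have u: "0 \<le> u n \<and> u n \<le> 1" for n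
  proof (induction n)
    case (Suc n)
    then have "u n * u n \<le> 1" by (simp add: mult_le_one)
    then show ?case unfolding uS by simp
  qed (simp add: u0)
  have uinc: "u n \<le> u (Suc n)" for n
  proof -
    have "0 \<le> (1 - u n) * (1 - u n)" by simp
    then show ?thesis unfolding uS by (simp add: algebra_simps)
  qed
  have yu: "norm (y n) \<le> u n" for n
  proof (induction n)
    case (Suc n)
    have "norm (y n * y n) \<le> u n * u n"
      using norm_mult_ineq[of "y n" "y n"] mult_mono[OF Suc Suc] u[of n] by simp
    then show ?case unfolding yS uS using norm_triangle_ineq[of x "y n * y n"] x by simp
  qed (simp add: y0 u0)
  \<comment> \<open>Used three times: with iterates as \<open>b\<close>, so that differences of
    squares factor; with \<open>b = x\<close>; and in the limit, for the commutation clause of the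
    conclusion.\<close>
  have comm: "b * y n = y n * b" if b: "b * x = x * b" for b n
  proof (induction n)
    case (Suc n)
    have "b * (y n * y n) = (y n * y n) * b" using Suc by (metis mult.assoc)
    then show ?case unfolding yS using b by (simp add: distrib_left distrib_right)
  qed (simp add: y0)
  have yy: "y m * y n = y n * y m" for m n
    using comm[of "y m" n] comm[of x m] by simp
  have step: "norm (y (Suc n) - y n) \<le> u (Suc n) - u n" for n
  proof (induction n)
    case 0 then show ?case using x unfolding yS uS y0 u0 by simp
  next
    case (Suc n)
    have "y (Suc (Suc n)) - y (Suc n) = (1 / 2) *\<^sub>R (y (Suc n) * y (Suc n) - y n * y n)"
      unfolding yS[of "Suc n"] yS[of n] by (simp add: yS[of n, symmetric] algebra_simps)
    also have "y (Suc n) * y (Suc n) - y n * y n = (y (Suc n) - y n) * (y (Suc n) + y n)"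
      using yy[of "Suc n" n] by (simp add: algebra_simps)
    finally have "norm (y (Suc (Suc n)) - y (Suc n)) = (1 / 2) * norm ((y (Suc n) - y n) * (y (Suc n) + y n))"
      by simp
    also have "\<dots> \<le> (1 / 2) * ((u (Suc n) - u n) * (u (Suc n) + u n))"
    proof -
      have "norm (y (Suc n) + y n) \<le> u (Suc n) + u n"
        using yu[of n] yu[of "Suc n"] norm_triangle_ineq[of "y (Suc n)" "y n"] by linarith
      then have "norm (y (Suc n) - y n) * norm (y (Suc n) + y n) \<le> (u (Suc n) - u n) * (u (Suc n) + u n)"
        using Suc uinc[of n] by (intro mult_mono) auto
      then show ?thesis using norm_mult_ineq[of "y (Suc n) - y n" "y (Suc n) + y n"] by linarith
    qed
    also have "\<dots> = u (Suc (Suc n)) - u (Suc n)"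
      unfolding uS[of "Suc n"] by (subst (5) uS) (simp add: algebra_simps)
    finally show ?case .
  qed
  have "Bseq u" by (rule BseqI'[where K = 1]) (use u in simp)
  moreover have "\<forall>m n. m \<le> n \<longrightarrow> u m \<le> u n" using uinc by (auto intro: lift_Suc_mono_le)
  ultimately have "convergent u" by (rule Bseq_mono_convergent)
  \<comment> \<open>The increments of the bounded increasing sequence \<open>u\<close> telescope to
    a finite sum, and they dominate those of \<open>y\<close>.\<close>
  then have "summable (\<lambda>n. u (Suc n) - u n)"
    by (intro telescope_summable[of u "lim u"]) (simp only: convergent_LIMSEQ_iff)
  then have "summable (\<lambda>n. y (Suc n) - y n)"
    by (rule summable_comparison_test'[where N = 0]) (use step in auto)
  then have "convergent (\<lambda>n. \<Sum>k<n. y (Suc k) - y k)" by (simp add: summable_iff_convergent)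
  then have "convergent y" by (simp add: sum_lessThan_telescope y0)
  then obtain z where z: "y \<longlonglongrightarrow> z" unfolding convergent_def by auto
  have zz: "z = (1 / 2) *\<^sub>R (x + z * z)"
  proof (rule LIMSEQ_unique)
    show "(\<lambda>n. y (Suc n)) \<longlonglongrightarrow> z" using z by (rule LIMSEQ_Suc)
    show "(\<lambda>n. y (Suc n)) \<longlonglongrightarrow> (1 / 2) *\<^sub>R (x + z * z)" unfolding yS by (intro tendsto_intros z)
  qed
  have sa: "star (y n) = y n" for n
    by (induction n) (simp_all add: y0 yS star_scaleR star_add star_mult x_def star_diff positive_self_adjoint[OF pos])
  have "positive (1 - z)"
  proof (rule positive_limit)
    show "(\<lambda>n. 1 - y n) \<longlonglongrightarrow> 1 - z" by (intro tendsto_intros z)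
    show "positive (1 - y n)" for n
    proof (rule positiveI_norm)
      have "norm (y n) \<le> 1" using yu[of n] u[of n] by linarith
      then show "norm (1 *\<^sub>R 1 - (1 - y n)) \<le> 1" by simp
    qed (simp add: star_diff sa)
  qed
  moreover have "(1 - z) * (1 - z) = a"
  proof -
    have "2 *\<^sub>R z = x + z * z" using arg_cong[OF zz, of "\<lambda>v. 2 *\<^sub>R v"] by simp
    then have "1 - z - z + z * z = 1 - x" by (simp add: scaleR_2 algebra_simps)
    then show ?thesis unfolding x_def by (simp add: algebra_simps)
  qed
  moreover have "b * (1 - z) = (1 - z) * b" if b: "b * a = a * b" for b
  proof -
    have bx: "b * x = x * b" unfolding x_def using b by (simp add: algebra_simps)
    have "(\<lambda>n. b * y n) \<longlonglongrightarrow> b * z" "(\<lambda>n. b * y n) \<longlonglongrightarrow> z * b"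
      by (intro tendsto_intros z) (unfold comm[OF bx], intro tendsto_intros z)
    then have "b * z = z * b" by (rule LIMSEQ_unique)
    then show ?thesis by (simp add: algebra_simps)
  qed
  ultimately show ?thesis by blast
qed

text \<open>Rescaling reduces to norm at most 1. The commutation clause serves uniqueness: any other
  root \<open>b\<close> commutes with \<open>a = b * b\<close>, hence with \<open>r\<close>.\<close>

lemma sqrt_exists:
  fixes a :: "'a::unital_cstar_algebra"
  assumes "positive a"
  obtains r where "positive r" "r * r = a" "\<And>b. b * a = a * b \<Longrightarrow> b * r = r * b"
proof (cases "a = 0")
  case True
  then show ?thesis using that[of 0] positive_zero by simp
next
  case False
  define n where "n = norm a"
  have n: "n > 0" unfolding n_def using False by simp
  have "positive ((1 / n) *\<^sub>R a)" "norm ((1 / n) *\<^sub>R a) \<le> 1"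
    using assms n by (auto intro: positive_scaleR) (simp add: n_def)
  then obtain s where s: "positive s" "s * s = (1 / n) *\<^sub>R a"
    "\<And>b. b * ((1 / n) *\<^sub>R a) = ((1 / n) *\<^sub>R a) * b \<Longrightarrow> b * s = s * b"
    using sqrt_exists_norm_le_1 by metis
  show ?thesis
  proof (rule that)
    show "positive (sqrt n *\<^sub>R s)" using s(1) n by (intro positive_scaleR) auto
    show "(sqrt n *\<^sub>R s) * (sqrt n *\<^sub>R s) = a" using s(2) n by simp
    show "b * (sqrt n *\<^sub>R s) = (sqrt n *\<^sub>R s) * b" if "b * a = a * b" for b
      using s(3)[of b] that by simp
  qed
qed

text \<open>A root \<open>s\<close> of \<open>p\<close> commutes with \<open>h\<close>, so
  \<open>h * p * h\<close> is the square of the self-adjoint \<open>h * s\<close>. No inverse of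
  \<open>h\<close> is involved, so \<open>h\<close> may be a difference of two roots.\<close>

lemma positive_conjugate_commuting:
  assumes "positive p" "star h = h" "h * p = p * h" shows "positive (h * p * h)"
proof -
  obtain s where s: "positive s" "s * s = p" "h * s = s * h"
    using sqrt_exists[OF assms(1)] assms(3) by metis
  have "star (h * s) = h * s" using s assms(2) by (simp add: star_mult positive_self_adjoint)
  then have "positive ((h * s) * (h * s))" by (rule positive_square)
  also have "(h * s) * (h * s) = h * p * h" using s(2,3) by (metis mult.assoc)
  finally show ?thesis .
qed

text \<open>With \<open>h = b - r\<close> the equation \<open>b\<^sup>2 = r\<^sup>2\<close> gives \<open>h b h + h r h = 0\<close>, so both summands vanish,
  and so does their difference \<open>h\<^sup>3\<close>.\<close>

lemma pos_sqrt_unique: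
  fixes b :: "'a::unital_cstar_algebra"
  assumes b: "positive b" "b * b = a" and r: "positive r" "r * r = a"
    and comm: "b * r = r * b"
  shows "b = r"
proof -
  define h where "h = b - r"
  have h: "star h = h" "h * b = b * h" "h * r = r * h"
    unfolding h_def using b r comm by (simp_all add: star_diff positive_self_adjoint algebra_simps)
  have "h * (b + r) = 0" unfolding h_def using b r comm by (simp add: algebra_simps)
  then have "h * (b + r) * h = 0" by simp
  then have "h * b * h + h * r * h = 0" by (simp add: distrib_left distrib_right)
  then have eq: "h * r * h = - (h * b * h)" by (simp add: eq_neg_iff_add_eq_0 add.commute)
  have "h * b * h = 0"
    using positive_conjugate_commuting[OF b(1) h(1,2)] positive_conjugate_commuting[OF r(1) h(1,3)]
    unfolding eq by (rule positive_antisym)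
  moreover have "h * h * h = h * b * h - h * r * h"
    by (subst (2) h_def) (simp add: left_diff_distrib right_diff_distrib)
  ultimately have "h * h * h = 0" using eq by simp
  \<comment> \<open>Passing from the cube to the fourth power allows the C*-identity to be applied
    twice.\<close>
  then have "norm ((h * h) * (h * h)) = 0" by (metis mult.assoc mult_zero_left norm_zero)
  then have "h = 0"
    using norm_self_adjoint_square[of "h * h"] norm_self_adjoint_square[OF h(1)] h(1)
    by (simp add: star_mult)
  then show ?thesis unfolding h_def by simp
qed

lemma pos_sqrt:
  fixes a :: "'a::unital_cstar_algebra"
  assumes "positive a" shows "positive (pos_sqrt a)" "pos_sqrt a ^ 2 = a"
proof -
  obtain r where r: "positive r" "r * r = a" "\<And>b. b * a = a * b \<Longrightarrow> b * r = r * b"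
    using sqrt_exists[OF assms] by metis
  have "\<exists>!b. positive b \<and> b ^ 2 = a"
  proof (rule ex1I[of _ r])
    fix b assume b: "positive b \<and> b ^ 2 = a"
    then have bb: "b * b = a" by (simp add: power2_eq_square)
    then have "b * r = r * b" by (intro r) (simp add: mult.assoc flip: bb)
    then show "b = r" using pos_sqrt_unique b bb r by blast
  next
    show "positive r \<and> r ^ 2 = a" using r(1,2) by (simp add: power2_eq_square)
  qed
  then have "positive (pos_sqrt a) \<and> pos_sqrt a ^ 2 = a"
    unfolding pos_sqrt_def by (rule theI')
  then show "positive (pos_sqrt a)" "pos_sqrt a ^ 2 = a" by auto
qed

lemma inverse_sqrt_exists:
  fixes b :: "'a::unital_cstar_algebra"
  assumes "positive b" "alg_invertible b"
  obtains a k where "star a = a" "star k = k" "a * k = 1" "k * a = 1" "k * k = b"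
proof -
  obtain k where k: "positive k" "k * k = b" using sqrt_exists[OF assms(1)] by metis
  then have "alg_invertible k" using alg_invertible_factor[of k k] assms(2) by simp
  then obtain a where a: "k * a = 1" "a * k = 1" unfolding alg_invertible_def by auto
  then show ?thesis
    using that[of a k] k self_adjoint_inverse[OF positive_self_adjoint[OF k(1)] a]
    by (simp add: positive_self_adjoint)
qed

section \<open>States and strictly positive elements\<close>

text \<open>Zorn's lemma applied to the cones avoiding \<open>- e\<close>. If \<open>x\<close> is
  outside a maximal \<open>M\<close>, the cone spanned by \<open>M\<close> and \<open>x\<close>
  contains \<open>- e = m + t x\<close> with \<open>t > 0\<close>, so \<open>- x\<close> is a
  positive multiple of \<open>m + e\<close> and lies in \<open>M\<close>.\<close>

lemma maximal_cone_exists: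
  fixes C :: "'v::real_vector set"
  assumes C: "convex_cone C" "e \<in> C" "- e \<notin> C"
  obtains M where "convex_cone M" "C \<subseteq> M" "- e \<notin> M" "\<And>x. x \<in> M \<or> - x \<in> M"
proof -
  define S where "S = {M. convex_cone M \<and> C \<subseteq> M \<and> - e \<notin> M}"
  have "\<exists>M\<in>S. \<forall>X\<in>S. M \<subseteq> X \<longrightarrow> X = M"
  proof (rule subset_Zorn_nonempty)
    show "S \<noteq> {}" unfolding S_def using C by auto
    fix \<C> assume ne: "\<C> \<noteq> {}" and ch: "subset.chain S \<C>"
    have sub: "\<C> \<subseteq> S" and lin: "\<And>X Y. X \<in> \<C> \<Longrightarrow> Y \<in> \<C> \<Longrightarrow> X \<subseteq> Y \<or> Y \<subseteq> X"
      using ch unfolding subset_chain_def by auto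
    have "convex_cone (\<Union>\<C>)"
      unfolding convex_cone_iff
    proof (intro conjI ballI allI impI)
      show "0 \<in> \<Union>\<C>" using ne sub convex_cone_contains_0 unfolding S_def by blast
    next
      fix x y assume "x \<in> \<Union>\<C>" "y \<in> \<Union>\<C>"
      then obtain X Y where XY: "X \<in> \<C>" "Y \<in> \<C>" "x \<in> X" "y \<in> Y" by auto
      then obtain Z where "Z \<in> \<C>" "x \<in> Z" "y \<in> Z" using lin[of X Y] by blast
      moreover from this have "convex_cone Z" using sub unfolding S_def by auto
      ultimately show "x + y \<in> \<Union>\<C>" using convex_cone_add by blast
    next
      fix x and t :: real assume "x \<in> \<Union>\<C>" "0 \<le> t"
      then show "t *\<^sub>R x \<in> \<Union>\<C>" using sub convex_cone_scaleR unfolding S_def by blast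
    qed
    then show "\<Union>\<C> \<in> S" using ne sub unfolding S_def by auto
  qed
  then obtain M where M: "convex_cone M" "C \<subseteq> M" "- e \<notin> M"
    and max: "\<And>X. convex_cone X \<Longrightarrow> C \<subseteq> X \<Longrightarrow> - e \<notin> X \<Longrightarrow> M \<subseteq> X \<Longrightarrow> X = M"
    unfolding S_def by auto
  have eM: "e \<in> M" using C M by auto
  have zM: "0 \<in> M" by (rule convex_cone_contains_0[OF M(1)])
  have "- x \<in> M" if x: "x \<notin> M" for x
  proof -
    define X where "X = {m + t *\<^sub>R x | m t. m \<in> M \<and> 0 \<le> t}"
    have MX: "M \<subseteq> X"
    proof
      fix m assume "m \<in> M"
      then have "m = m + 0 *\<^sub>R x \<and> m \<in> M \<and> 0 \<le> (0::real)" by simp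
      then show "m \<in> X" unfolding X_def by blast
    qed
    have "convex_cone X"
      unfolding convex_cone_iff
    proof (intro conjI ballI allI impI)
      show "0 \<in> X" using MX zM by blast
    next
      fix u v assume "u \<in> X" "v \<in> X"
      then obtain m s n t where "m \<in> M" "0 \<le> s" "u = m + s *\<^sub>R x" "n \<in> M" "0 \<le> t" "v = n + t *\<^sub>R x"
        unfolding X_def by auto
      then have "u + v = (m + n) + (s + t) *\<^sub>R x" "m + n \<in> M" "0 \<le> s + t"
        using convex_cone_add[OF M(1)] by (auto simp: algebra_simps)
      then show "u + v \<in> X" unfolding X_def by blast
    next
      fix u and r :: real assume "u \<in> X" and r: "0 \<le> r"
      then obtain m s where "m \<in> M" "0 \<le> s" "u = m + s *\<^sub>R x" unfolding X_def by auto
      then have "r *\<^sub>R u = r *\<^sub>R m + (r * s) *\<^sub>R x" "r *\<^sub>R m \<in> M" "0 \<le> r * s"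
        using convex_cone_scaleR[OF M(1)] r by (auto simp: algebra_simps)
      then show "r *\<^sub>R u \<in> X" unfolding X_def by blast
    qed
    moreover have "x \<in> X"
    proof -
      have "x = 0 + 1 *\<^sub>R x \<and> 0 \<in> M \<and> 0 \<le> (1::real)" using zM by simp
      then show ?thesis unfolding X_def by blast
    qed
    ultimately have "- e \<in> X" using max[of X] MX M(2) x by blast
    then obtain m t where t: "m \<in> M" "0 \<le> t" "- e = m + t *\<^sub>R x" unfolding X_def by auto
    have "t \<noteq> 0" using t M(3) by auto
    have "(1 / t) *\<^sub>R (m + e) \<in> M"
      using convex_cone_add[OF M(1)] convex_cone_scaleR[OF M(1)] t eM by simp
    also have "m + e = t *\<^sub>R (- x)" using t(3) by (metis add.commute add.left_inverse add_eq_0_iff minus_add_cancel scaleR_minus_right)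
    finally show ?thesis using \<open>t \<noteq> 0\<close> by simp
  qed
  then show ?thesis using that M by blast
qed

text \<open>A Hahn-Banach argument by Dedekind cuts: \<open>f x\<close> is the supremum of the
  \<open>r\<close> with \<open>x - r e\<close> in a maximal cone \<open>M\<close>. The order unit
  \<open>e\<close> makes these cuts nonempty and bounded.\<close>

lemma cone_functional_exists:
  fixes C :: "'v::real_vector set"
  assumes C: "convex_cone C" "e \<in> C" "- e \<notin> C"
    and unit: "\<And>x. \<exists>t. t *\<^sub>R e - x \<in> C"
  obtains f :: "'v \<Rightarrow> real" where "linear f" "\<And>x. x \<in> C \<Longrightarrow> 0 \<le> f x" "f e = 1"
proof -
  obtain M where M: "convex_cone M" "C \<subseteq> M" "- e \<notin> M" "\<And>x. x \<in> M \<or> - x \<in> M"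
    using maximal_cone_exists[OF C] by metis
  have eM: "r *\<^sub>R e \<in> M \<longleftrightarrow> 0 \<le> r" for r
  proof
    show "0 \<le> r" if r: "r *\<^sub>R e \<in> M"
    proof (rule ccontr)
      assume "\<not> 0 \<le> r"
      then have "(1 / - r) *\<^sub>R r *\<^sub>R e \<in> M" using convex_cone_scaleR[OF M(1) _ r, of "1 / - r"] by simp
      with \<open>\<not> 0 \<le> r\<close> M(3) show False by simp
    qed
    show "0 \<le> r \<Longrightarrow> r *\<^sub>R e \<in> M" using convex_cone_scaleR[OF M(1)] C M(2) by blast
  qed
  define L where "L x = {r. x - r *\<^sub>R e \<in> M}" for x
  define f where "f x = Sup (L x)" for x
  have ub: "r \<le> t" if r: "r \<in> L x" and t: "t *\<^sub>R e - x \<in> M" for r t x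
  proof -
    have "(t *\<^sub>R e - x) + (x - r *\<^sub>R e) \<in> M" using r t convex_cone_add[OF M(1)] unfolding L_def by blast
    then have "(t - r) *\<^sub>R e \<in> M" by (simp add: algebra_simps)
    then show ?thesis using eM by simp
  qed
  have ne: "L x \<noteq> {}" for x
  proof -
    obtain t where "t *\<^sub>R e - (- x) \<in> C" using unit by blast
    then have "x - (- t) *\<^sub>R e \<in> M" using M(2) by (auto simp: add.commute)
    then show ?thesis unfolding L_def by blast
  qed
  have bdd: "bdd_above (L x)" for x
  proof -
    obtain t where "t *\<^sub>R e - x \<in> C" using unit by blast
    then show ?thesis using ub M(2) by (intro bdd_aboveI) blast
  qed
  have lower: "r \<le> f x" if "x - r *\<^sub>R e \<in> M" for r x
    unfolding f_def using that by (intro cSup_upper bdd) (simp add: L_def)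
  have upper: "f x \<le> t" if "t *\<^sub>R e - x \<in> M" for t x
    unfolding f_def by (rule cSup_least[OF ne]) (use ub that in blast)
  \<comment> \<open>Since \<open>M\<close> contains one of each pair of opposite vectors, every
    \<open>r\<close> other than \<open>f x\<close> lies strictly on one side of the cut; adding such
    memberships yields additivity up to any \<open>d > 0\<close>.\<close>
  have above: "r *\<^sub>R e - x \<in> M" if "f x < r" for r x
    using lower[of x r] M(4)[of "x - r *\<^sub>R e"] that by auto
  have below: "x - r *\<^sub>R e \<in> M" if "r < f x" for r x
    using upper[of r x] M(4)[of "x - r *\<^sub>R e"] that by auto
  have add: "f (x + y) = f x + f y" for x y
  proof (rule antisym)
    show "f (x + y) \<le> f x + f y"
    proof (rule field_le_epsilon)
      fix d :: real assume "0 < d"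
      then have "((f x + d / 2) *\<^sub>R e - x) + ((f y + d / 2) *\<^sub>R e - y) \<in> M"
        by (intro convex_cone_add[OF M(1)] above) auto
      then have "(f x + d / 2 + (f y + d / 2)) *\<^sub>R e - (x + y) \<in> M"
        by (metis add_diff_add scaleR_left.add)
      then show "f (x + y) \<le> f x + f y + d" using upper by fastforce
    qed
    show "f x + f y \<le> f (x + y)"
    proof (rule field_le_epsilon)
      fix d :: real assume "0 < d"
      then have "(x - (f x - d / 2) *\<^sub>R e) + (y - (f y - d / 2) *\<^sub>R e) \<in> M"
        by (intro convex_cone_add[OF M(1)] below) auto
      then have "(x + y) - (f x - d / 2 + (f y - d / 2)) *\<^sub>R e \<in> M"
        by (metis add_diff_add scaleR_left.add)
      then show "f x + f y \<le> f (x + y) + d" using lower by fastforce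
    qed
  qed
  have nonneg: "0 \<le> f x" if "x \<in> M" for x using lower[of x 0] that by simp
  have fe: "f e = 1"
    using lower[of e 1] upper[of 1 e] eM[of 0] by simp
  have le: "r * f x \<le> f (r *\<^sub>R x)" if r: "0 < r" for r x
  proof (rule field_le_epsilon)
    fix d :: real assume "0 < d"
    then have "x - (f x - d / r) *\<^sub>R e \<in> M" using r by (intro below) simp
    then have "r *\<^sub>R (x - (f x - d / r) *\<^sub>R e) \<in> M" using convex_cone_scaleR[OF M(1)] r by simp
    moreover have "r *\<^sub>R (x - (f x - d / r) *\<^sub>R e) = r *\<^sub>R x - (r * f x - d) *\<^sub>R e"
      using r by (simp add: right_diff_distrib scaleR_diff_right)
    ultimately have "r * f x - d \<le> f (r *\<^sub>R x)" by (intro lower) simp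
    then show "r * f x \<le> f (r *\<^sub>R x) + d" by simp
  qed
  have pos: "f (r *\<^sub>R x) = r * f x" if r: "0 < r" for r x
  proof (rule antisym)
    have "(1 / r) * f (r *\<^sub>R x) \<le> f x" using le[of "1 / r" "r *\<^sub>R x"] r by simp
    then show "f (r *\<^sub>R x) \<le> r * f x" using r by (simp add: field_simps)
  qed (rule le[OF r])
  have f0: "f 0 = 0" using add[of 0 0] by simp
  have neg: "f (- x) = - f x" for x using add[of x "- x"] f0 by simp
  have "f (r *\<^sub>R x) = r * f x" for r x
  proof (cases "r = 0")
    case False
    then show ?thesis using pos[of r x] pos[of "- r" x] neg[of "r *\<^sub>R x"] by (cases "0 < r") auto
  qed (simp add: f0)
  then have "linear f" by (intro linearI) (simp_all add: add)
  then show ?thesis using that fe nonneg M(2) by blast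
qed

text \<open>This is the complex-linear functional with real part \<open>f\<close>.\<close>

lemma linear_form_complexification:
  fixes f :: "'a::unital_cstar_algebra \<Rightarrow> real"
  assumes "linear f"
  shows "linear_form (\<lambda>a. Complex (f a) (- f (\<i> *\<^sub>C a)))"
  unfolding linear_form_def
proof (intro conjI allI)
  fix c and a :: 'a
  have c: "c *\<^sub>C b = Re c *\<^sub>R b + Im c *\<^sub>R (\<i> *\<^sub>C b)" for b :: 'a
    by (subst (1) complex_eq[of c]) (simp add: scaleC_simps scaleR_scaleC mult.commute)
  have "\<i> *\<^sub>C c *\<^sub>C a = c *\<^sub>C \<i> *\<^sub>C a" by (simp add: scaleC_scaleC mult.commute)
  also have "\<dots> = Re c *\<^sub>R (\<i> *\<^sub>C a) - Im c *\<^sub>R a" by (subst c) (simp add: scaleC_scaleC scaleC_one)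
  finally have ic: "\<i> *\<^sub>C c *\<^sub>C a = Re c *\<^sub>R (\<i> *\<^sub>C a) - Im c *\<^sub>R a" .
  have "f (c *\<^sub>C a) = Re c * f a + Im c * f (\<i> *\<^sub>C a)"
    by (subst c) (simp add: linear_add[OF assms] linear_scale[OF assms])
  then show "Complex (f (c *\<^sub>C a)) (- f (\<i> *\<^sub>C c *\<^sub>C a)) = c * Complex (f a) (- f (\<i> *\<^sub>C a))"
    unfolding ic
    by (simp add: complex_eq_iff linear_diff[OF assms] linear_scale[OF assms])
qed (simp add: complex_eq_iff scaleC_add_right linear_add[OF assms])

text \<open>The functional comes from the cone of all \<open>x\<close> whose hermitian part lies in
  \<open>P - \<real>\<^sub>\<ge>\<^sub>0 h\<close>, \<open>P\<close> being the positive cone; it vanishes on skew-adjoint elements, which this cone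
  contains together with their negatives.\<close>

lemma state_nonpositive_exists:
  fixes h :: "'a::unital_cstar_algebra"
  assumes sa: "star h = h" and nb: "\<And>d. 0 < d \<Longrightarrow> \<not> positive (h - d *\<^sub>R 1)"
  obtains \<phi> where "positive_form \<phi>" "\<phi> 1 = 1" "Re (\<phi> h) \<le> 0"
proof -
  \<comment> \<open>In the zero algebra every element is positive, against
    \<open>nb\<close>.\<close>
  have nz: "(1::'a) \<noteq> 0"
    using nb[of 1] positive_zero eq_zero_of_trivial[of "h - 1"] by auto
  define C where "C = {x. \<exists>p t. positive p \<and> 0 \<le> t \<and> x + star x = p - t *\<^sub>R h}"
  have CI: "x \<in> C" if "positive p" "0 \<le> t" "x + star x = p - t *\<^sub>R h" for x p t
    using that unfolding C_def by blast
  have cone: "convex_cone C"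
    unfolding convex_cone_iff
  proof (intro conjI ballI allI impI)
    show "0 \<in> C" by (rule CI[OF positive_zero order_refl]) simp
  next
    fix x y assume "x \<in> C" "y \<in> C"
    then obtain p s q t where pq: "positive p" "0 \<le> s" "x + star x = p - s *\<^sub>R h"
      "positive q" "0 \<le> t" "y + star y = q - t *\<^sub>R h" unfolding C_def by auto
    have "x + y + star (x + y) = (x + star x) + (y + star y)" by (simp add: star_add algebra_simps)
    also have "\<dots> = (p + q) - (s + t) *\<^sub>R h" unfolding pq by (simp add: algebra_simps)
    finally show "x + y \<in> C" using pq by (intro CI[of "p + q" "s + t"] positive_add) auto
  next
    fix x and r :: real assume "x \<in> C" "0 \<le> r"
    then obtain p s where p: "positive p" "0 \<le> s" "x + star x = p - s *\<^sub>R h" unfolding C_def by auto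
    have "r *\<^sub>R x + star (r *\<^sub>R x) = r *\<^sub>R (x + star x)" by (simp add: star_scaleR algebra_simps)
    also have "\<dots> = r *\<^sub>R p - (r * s) *\<^sub>R h" unfolding p by (simp add: algebra_simps)
    finally show "r *\<^sub>R x \<in> C" using p \<open>0 \<le> r\<close> by (intro CI[of "r *\<^sub>R p" "r * s"] positive_scaleR) auto
  qed
  have one: "1 \<in> C"
    by (rule CI[OF positive_scaleR_one[of 2] order_refl]) (simp_all add: scaleR_2)
  \<comment> \<open>Membership would mean \<open>t h = p + 2\<close>. For \<open>t > 0\<close> this
    bounds \<open>h\<close> below by \<open>2 / t\<close>, against \<open>nb\<close>; for
    \<open>t = 0\<close> it makes \<open>- 2\<close> positive.\<close>
  have minus_one: "- 1 \<notin> C"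
  proof
    assume "- 1 \<in> C"
    then obtain p t where p: "positive p" "0 \<le> t" "(- 1) + star (- 1) = p - t *\<^sub>R h" unfolding C_def by auto
    then have th: "t *\<^sub>R h = p + 2 *\<^sub>R 1" by (simp add: scaleR_2 algebra_simps)
    show False
    proof (cases "t = 0")
      case True
      then have "positive (- (2 *\<^sub>R 1 :: 'a))" using th p(1) by (metis add_eq_0_iff2 scale_zero_left)
      then have "2 *\<^sub>R (1::'a) = 0" by (intro positive_antisym positive_scaleR_one) auto
      then show False using nz by simp
    next
      case False
      have "h = (1 / t) *\<^sub>R t *\<^sub>R h" using False by simp
      also have "\<dots> = (1 / t) *\<^sub>R p + (2 / t) *\<^sub>R 1" unfolding th by (simp add: scaleR_add_right)
      finally have "h - (2 / t) *\<^sub>R 1 = (1 / t) *\<^sub>R p" by simp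
      then show False using nb[of "2 / t"] positive_scaleR[OF p(1), of "1 / t"] p(2) False by simp
    qed
  qed
  have unit: "\<exists>t. t *\<^sub>R 1 - x \<in> C" for x
  proof -
    define s where "s = norm (x + star x)"
    have "positive (s *\<^sub>R 1 - (x + star x))"
      unfolding s_def by (rule positive_norm_minus) (simp add: star_add star_star add.commute)
    moreover have "((s / 2) *\<^sub>R 1 - x) + star ((s / 2) *\<^sub>R 1 - x) = (s *\<^sub>R 1 - (x + star x)) - 0 *\<^sub>R h"
    proof -
      have "(s / 2) *\<^sub>R (1::'a) + (s / 2) *\<^sub>R 1 = s *\<^sub>R 1" by (simp flip: scaleR_add_left)
      then show ?thesis by (simp add: star_diff star_scaleR algebra_simps)
    qed
    ultimately have "(s / 2) *\<^sub>R 1 - x \<in> C" by (rule CI[OF _ order_refl])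
    then show ?thesis by blast
  qed
  obtain f :: "'a \<Rightarrow> real" where f: "linear f" "\<And>x. x \<in> C \<Longrightarrow> 0 \<le> f x" "f 1 = 1"
    using cone_functional_exists[OF cone one minus_one unit] by blast
  have skew: "f (\<i> *\<^sub>C p) = 0" if "star p = p" for p
  proof -
    have "\<i> *\<^sub>C p \<in> C" "- (\<i> *\<^sub>C p) \<in> C"
      by (rule CI[OF positive_zero order_refl]; simp add: star_scaleC that)+
    then have "0 \<le> f (\<i> *\<^sub>C p)" "0 \<le> f (- (\<i> *\<^sub>C p))" using f(2) by blast+
    then show ?thesis by (simp add: linear_neg[OF f(1)])
  qed
  define \<phi> where "\<phi> a = Complex (f a) (- f (\<i> *\<^sub>C a))" for a
  have "positive_form \<phi>"
    unfolding positive_form_def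
  proof (intro conjI allI impI)
    show "linear_form \<phi>" unfolding \<phi>_def by (rule linear_form_complexification[OF f(1)])
    fix p :: 'a assume p: "positive p"
    show "\<phi> p \<in> \<real>" unfolding \<phi>_def by (simp add: complex_is_Real_iff skew positive_self_adjoint[OF p])
    have "p \<in> C"
      by (rule CI[OF positive_add[OF p p] order_refl]) (simp add: positive_self_adjoint[OF p])
    then show "0 \<le> Re (\<phi> p)" unfolding \<phi>_def using f(2) by simp
  qed
  moreover have "\<phi> 1 = 1" unfolding \<phi>_def by (simp add: skew f complex_eq_iff)
  moreover have "Re (\<phi> h) \<le> 0"
  proof -
    have "- h \<in> C" by (rule CI[OF positive_zero, of 2]) (simp_all add: sa scaleR_2)
    then show ?thesis using f(2)[of "- h"] unfolding \<phi>_def by (simp add: linear_neg[OF f(1)])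
  qed
  ultimately show ?thesis using that by blast
qed

lemma linear_formD:
  assumes "linear_form \<phi>"
  shows "\<phi> (a + b) = \<phi> a + \<phi> b" "\<phi> (c *\<^sub>C a) = c * \<phi> a" "\<phi> (r *\<^sub>R a) = of_real r * \<phi> a"
    "\<phi> (a - b) = \<phi> a - \<phi> b"
proof -
  show add: "\<phi> (a + b) = \<phi> a + \<phi> b" and sc: "\<phi> (c *\<^sub>C a) = c * \<phi> a" for a b c
    using assms unfolding linear_form_def by auto
  show "\<phi> (r *\<^sub>R a) = of_real r * \<phi> a" by (simp add: scaleR_scaleC sc)
  show "\<phi> (a - b) = \<phi> a - \<phi> b"
    using add[of a "(-1) *\<^sub>C b"] sc[of "-1" b] by (simp add: scaleC_one)
qed

lemma positive_formD:
  assumes "positive_form \<phi>"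
  shows "linear_form \<phi>" "positive a \<Longrightarrow> \<phi> a \<in> \<real>" "positive a \<Longrightarrow> 0 \<le> Re (\<phi> a)"
  using assms unfolding positive_form_def by auto

text \<open>Both claims follow by evaluating \<open>\<phi>\<close> at the positive elements
  \<open>norm h - h\<close> and \<open>norm h + h\<close>.\<close>

lemma positive_form_self_adjoint:
  assumes \<phi>: "positive_form \<phi>" and sa: "star h = h"
  shows "\<phi> h \<in> \<real>" "\<bar>Re (\<phi> h)\<bar> \<le> norm h * Re (\<phi> 1)"
proof -
  note lin = linear_formD[OF positive_formD(1)[OF \<phi>]]
  have m: "\<phi> (norm h *\<^sub>R 1 - h) \<in> \<real>" "0 \<le> Re (\<phi> (norm h *\<^sub>R 1 - h))"
    and p: "0 \<le> Re (\<phi> (norm h *\<^sub>R 1 + h))"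
    using positive_formD[OF \<phi>] positive_norm_minus[OF sa] positive_norm_plus[OF sa] by blast+
  have one: "\<phi> 1 \<in> \<real>" using positive_formD(2)[OF \<phi> positive_scaleR_one[of 1]] by simp
  show "\<bar>Re (\<phi> h)\<bar> \<le> norm h * Re (\<phi> 1)" using m p by (simp add: lin)
  show "\<phi> h \<in> \<real>" using m(1) one by (simp add: lin complex_is_Real_iff)
qed

lemma cartesian_decomposition:
  fixes a :: "'a::unital_cstar_algebra"
  obtains h k where "star h = h" "star k = k" "a = h + \<i> *\<^sub>C k"
proof
  define h where "h = (1 / 2) *\<^sub>R (a + star a)"
  define k where "k = (- \<i> / 2) *\<^sub>C (a - star a)"
  show "star h = h" unfolding h_def by (simp add: star_scaleR star_add star_star add.commute)
  show "star k = k" unfolding k_def by (simp add: star_scaleC star_diff star_star scaleC_diff_right)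
  have "\<i> *\<^sub>C k = (1 / 2) *\<^sub>R (a - star a)" unfolding k_def by (simp add: scaleC_scaleC scaleR_scaleC)
  then show "a = h + \<i> *\<^sub>C k" unfolding h_def by (simp flip: scaleR_add_right)
qed

text \<open>If \<open>\<phi> 1\<close> vanished, so would \<open>\<phi>\<close> on all self-adjoint
  elements, and then everywhere by the Cartesian decomposition.\<close>

lemma strictly_positive_scaleR_one:
  assumes "0 < r" shows "strictly_positive (r *\<^sub>R (1::'a::unital_cstar_algebra))"
  unfolding strictly_positive_def
proof (intro allI impI, elim conjE exE)
  fix \<phi> :: "'a \<Rightarrow> complex" and b assume \<phi>: "positive_form \<phi>" and b: "\<phi> b \<noteq> 0"
  note lin = linear_formD[OF positive_formD(1)[OF \<phi>]]
  have one: "\<phi> 1 \<in> \<real>" "0 \<le> Re (\<phi> 1)" using positive_formD(2,3)[OF \<phi> positive_scaleR_one[of 1]] by simp_all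
  have "Re (\<phi> 1) \<noteq> 0"
  proof
    assume "Re (\<phi> 1) = 0"
    then have zero: "\<phi> h = 0" if "star h = h" for h
      using positive_form_self_adjoint[OF \<phi> that] by (simp add: complex_is_Real_iff complex_eq_iff)
    obtain h k where "star h = h" "star k = k" "b = h + \<i> *\<^sub>C k" by (rule cartesian_decomposition)
    then show False using b by (simp add: lin zero)
  qed
  then show "\<phi> (r *\<^sub>R 1) \<in> \<real> \<and> 0 < Re (\<phi> (r *\<^sub>R 1))"
    using one assms by (simp add: lin complex_is_Real_iff)
qed

text \<open>A form is real on self-adjoint elements, so a strictly positive \<open>h + i k\<close> has \<open>\<phi> k = 0\<close>
  for all positive forms, whence \<open>k = 0\<close>.\<close>

lemma strictly_positive_self_adjoint_invertible:
  fixes a :: "'a::unital_cstar_algebra"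
  assumes a: "strictly_positive a"
  shows "star a = a" "alg_invertible a"
proof -
  obtain h k where hk: "star h = h" "star k = k" "a = h + \<i> *\<^sub>C k" by (rule cartesian_decomposition)
  have \<phi>a: "\<phi> k = 0 \<and> 0 < Re (\<phi> h)" if \<phi>: "positive_form \<phi>" "\<phi> 1 = 1" for \<phi>
  proof -
    have "\<phi> a \<in> \<real>" "0 < Re (\<phi> a)"
      using a \<phi> zero_neq_one unfolding strictly_positive_def by metis+
    moreover have "\<phi> h \<in> \<real>" "\<phi> k \<in> \<real>" using positive_form_self_adjoint(1)[OF \<phi>(1)] hk by auto
    ultimately show ?thesis
      by (simp add: hk(3) linear_formD[OF positive_formD(1)[OF \<phi>(1)]] complex_is_Real_iff complex_eq_iff)
  qed
  \<comment> \<open>If \<open>l\<close> vanishes at all states, each of them takes the value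
    \<open>e > 0\<close> at \<open>l + e\<close>, so \<open>l + e\<close> must have a positive
    scalar lower bound. Used for both \<open>k\<close> and \<open>- k\<close>.\<close>
  have pos: "positive l" if l: "star l = l" "\<And>\<phi>. positive_form \<phi> \<Longrightarrow> \<phi> 1 = 1 \<Longrightarrow> \<phi> l = 0" for l :: 'a
  proof (rule positive_if_positive_plus_small[where b = 1])
    fix e :: real assume e: "0 < e"
    have "\<exists>d>0. positive (l + e *\<^sub>R 1 - d *\<^sub>R 1)"
    proof (rule ccontr)
      assume "\<not> ?thesis"
      then obtain \<phi> where \<phi>: "positive_form \<phi>" "\<phi> 1 = 1" "Re (\<phi> (l + e *\<^sub>R 1)) \<le> 0"
        using state_nonpositive_exists[of "l + e *\<^sub>R 1"] l(1) by (auto simp: star_add star_scaleR)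
      then show False using e l(2)[OF \<phi>(1,2)] by (simp add: linear_formD[OF positive_formD(1)[OF \<phi>(1)]])
    qed
    then obtain d where "0 < d" "positive (l + e *\<^sub>R 1 - d *\<^sub>R 1)" by blast
    then show "positive (l + e *\<^sub>R 1)"
      using positive_add[OF _ positive_scaleR_one, of "l + e *\<^sub>R 1 - d *\<^sub>R 1" d] by simp
  qed
  have neg: "\<phi> (- k) = 0" if "positive_form \<phi>" "\<phi> 1 = 1" for \<phi>
    using \<phi>a[OF that] linear_formD(3)[OF positive_formD(1)[OF that(1)], of "-1" k] by simp
  have "k = 0" using pos[of k] pos[of "- k"] \<phi>a neg hk by (intro positive_antisym) auto
  then have ah: "a = h" using hk by simp
  show "star a = a" unfolding ah by fact
  \<comment> \<open>Otherwise some state would be nonpositive at \<open>h\<close>, against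
    \<open>\<phi>a\<close>.\<close>
  have "\<exists>d>0. positive (h - d *\<^sub>R 1)"
    using state_nonpositive_exists[OF hk(1)] \<phi>a by (metis not_less)
  then obtain d where "0 < d" "positive (h - d *\<^sub>R 1)" by blast
  then show "alg_invertible a" using positive_add_scaleR_one_invertible unfolding ah by fastforce
qed

section \<open>Hilbert modules\<close>

context hilbert_module
begin

lemma ip_act_right: "ip x (act a y) = ip x y * star a"
  using arg_cong[OF ip_act_left[of a y x], of star] by (simp add: star_mult ip_star)

lemma ip_diff_left: "ip (x - y) z = ip x z - ip y z"
  using ip_add_left[of "x - y" y z] by simp

lemma act_diff_right: "act a (x - y) = act a x - act a y"
  using act_add_right[of a "x - y" y] by simp

lemma ip_act_act: "ip (act a x) (act a x) = a * ip x x * star a"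
  by (simp add: ip_act_left ip_act_right mult.assoc)

lemma modulus_square: "modulus ip x ^ 2 = ip x x"
  unfolding modulus_def by (rule pos_sqrt(2)[OF ip_positive])

lemma norm_square: "norm x ^ 2 = norm (ip x x)"
proof -
  have "star (modulus ip x) = modulus ip x"
    unfolding modulus_def by (intro positive_self_adjoint pos_sqrt ip_positive)
  then show ?thesis
    using norm_self_adjoint_square[of "modulus ip x"] modulus_square[of x]
    by (simp add: norm_eq[of x] power2_eq_square)
qed

section \<open>Orthogonal projections and frame terms\<close>

lemma orth_proj_eqI:
  assumes K: "orth_complemented act ip K" and y: "y \<in> K" "x - y \<in> orth_complement ip K"
  shows "orth_proj ip K x = y"
  unfolding orth_proj_def
proof (rule the_equality)
  fix z assume z: "z \<in> K \<and> x - z \<in> orth_complement ip K"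
  have sub: "submodule act K" and int: "K \<inter> orth_complement ip K = {0}"
    using K unfolding orth_complemented_def by auto
  \<comment> \<open>\<open>submodule\<close> provides sums and the action only, so negatives come
    from acting by \<open>- 1\<close>.\<close>
  have "act (- 1) y = - y"
    using act_scaleC_left[of "-1" 1 y] by (simp add: act_one scaleC_one)
  then have "z - y \<in> K" using sub y(1) z unfolding submodule_def by (metis diff_conv_add_uminus)
  moreover have "z - y \<in> orth_complement ip K"
    using y(2) z unfolding orth_complement_def by (auto simp: ip_diff_left)
  ultimately have "z - y \<in> {0}" using int by blast
  then show "z = y" by simp
qed (use y in simp)

lemma orth_proj_props:
  assumes K: "orth_complemented act ip K"
  shows "orth_proj ip K x \<in> K" "x - orth_proj ip K x \<in> orth_complement ip K"
proof -
  obtain y z where yz: "y \<in> K" "z \<in> orth_complement ip K" "x = y + z"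
    using K unfolding orth_complemented_def by blast
  then have "orth_proj ip K x = y" by (intro orth_proj_eqI[OF K]) auto
  then show "orth_proj ip K x \<in> K" "x - orth_proj ip K x \<in> orth_complement ip K" using yz by auto
qed

lemma orth_proj_act:
  assumes K: "orth_complemented act ip K"
  shows "orth_proj ip K (act a x) = act a (orth_proj ip K x)"
proof (rule orth_proj_eqI[OF K])
  show "act a (orth_proj ip K x) \<in> K"
    using K orth_proj_props(1)[OF K] unfolding orth_complemented_def submodule_def by blast
  show "act a x - act a (orth_proj ip K x) \<in> orth_complement ip K"
    using orth_proj_props(2)[OF K, of x] unfolding orth_complement_def
    by (auto simp: ip_act_left simp flip: act_diff_right)
qed

text \<open>Centrality moves one factor \<open>\<omega> n\<close> to the right, which exhibits the
  term as a conjugate of a positive element by a commuting self-adjoint one.\<close>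

lemma positive_frame_term:
  assumes "weight \<omega>" "1 \<le> n" shows "positive (frame_term ip H \<omega> x n)"
proof -
  let ?p = "orth_proj ip (H n) x"
  have c: "\<omega> n * b = b * \<omega> n" for b using assms unfolding weight_def central_def by blast
  have "star (\<omega> n) = \<omega> n"
    using assms strictly_positive_self_adjoint_invertible(1) unfolding weight_def by blast
  then have "positive (\<omega> n * ip ?p ?p * \<omega> n)" by (intro positive_conjugate_commuting ip_positive c)
  moreover have "\<omega> n * ip ?p ?p * \<omega> n = frame_term ip H \<omega> x n"
    unfolding frame_term_def modulus_square
    by (simp only: power2_eq_square mult.assoc flip: c[of "ip ?p ?p"])
  ultimately show ?thesis by simp
qed

lemma frame_term_act:
  assumes "weight \<omega>" "1 \<le> n" "orth_complemented act ip (H n)"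
  shows "frame_term ip H \<omega> (act a x) n = a * frame_term ip H \<omega> x n * star a"
proof -
  have c: "\<omega> n * b = b * \<omega> n" for b using assms unfolding weight_def central_def by blast
  have "\<omega> n ^ 2 * a = a * \<omega> n ^ 2" unfolding power2_eq_square using c by (metis mult.assoc)
  then show ?thesis
    unfolding frame_term_def modulus_square orth_proj_act[OF assms(3)] ip_act_act
    by (metis mult.assoc)
qed

end

section \<open>From norm inequalities to order inequalities\<close>

lemma order_bound_if_norm_bound:
  fixes act :: "'a::unital_cstar_algebra \<Rightarrow> 'h \<Rightarrow> 'h" and F G :: "'h \<Rightarrow> 'a"
  assumes pos: "\<And>x. positive (F x)" "\<And>x. positive (G x)"
    and act: "\<And>a x. F (act a x) = a * F x * star a" "\<And>a x. G (act a x) = a * G x * star a"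
    and bound: "\<And>x. norm (F x) \<le> r * norm (G x)" and r: "0 \<le> r"
  shows "positive (r *\<^sub>R G x - F x)"
proof (rule positive_if_positive_plus_small[where b = "r *\<^sub>R 1"])
  fix e :: real assume e: "0 < e"
  obtain a k where ak: "star a = a" "star k = k" "a * k = 1" "k * a = 1" "k * k = G x + e *\<^sub>R 1"
  proof (rule inverse_sqrt_exists)
    show "positive (G x + e *\<^sub>R 1)" using e by (intro positive_add pos positive_scaleR_one) simp
    show "alg_invertible (G x + e *\<^sub>R 1)" by (rule positive_add_scaleR_one_invertible[OF pos(2) e])
  qed
  \<comment> \<open>The defect \<open>e *\<^sub>R (a * a)\<close> is positive, so
    \<open>G (act a x)\<close> lies below 1 and has norm at most 1.\<close>
  have aa: "1 - G (act a x) = e *\<^sub>R (a * a)"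
  proof -
    have "1 = a * (k * k) * a" using ak by (metis mult.assoc mult_1_left)
    also have "\<dots> = a * G x * a + e *\<^sub>R (a * a)" unfolding ak(5) by (simp add: distrib_left distrib_right)
    finally show ?thesis unfolding act ak(1) by (metis add_diff_cancel_left')
  qed
  have "norm (G (act a x)) \<le> 1"
    using positive_scaleR[OF positive_square[OF ak(1)], of e] e aa
    by (intro norm_le_if_positive_diff pos) auto
  then have n: "norm (F (act a x)) \<le> r" using bound[of "act a x"] r mult_left_mono[of _ 1 r] by fastforce
  have "positive (r *\<^sub>R 1 - F (act a x))"
    using positive_add[OF positive_norm_minus positive_scaleR_one, of "F (act a x)" "r - norm (F (act a x))"]
      n positive_self_adjoint[OF pos(1)]
    by (simp add: scaleR_diff_left)
  \<comment> \<open>Conjugating by \<open>k\<close>, the inverse of \<open>a\<close>, turns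
    \<open>F (act a x)\<close> back into \<open>F x\<close> and 1 into
    \<open>G x + e\<close>.\<close>
  then have "positive (k * (r *\<^sub>R 1 - F (act a x)) * k)"
    by (rule positive_conjugate[OF _ ak(2) alg_invertibleI[OF ak(4,3)]])
  also have "k * (r *\<^sub>R 1 - F (act a x)) * k = r *\<^sub>R (k * k) - (k * a) * F x * (a * k)"
    by (simp add: act ak(1) left_diff_distrib right_diff_distrib mult.assoc)
  also have "\<dots> = r *\<^sub>R G x - F x + e *\<^sub>R r *\<^sub>R 1" unfolding ak by (simp add: scaleR_add_right algebra_simps)
  finally show "positive (r *\<^sub>R G x - F x + e *\<^sub>R r *\<^sub>R 1)" .
qed

theorem theorem3p6:
  fixes act :: "'a::unital_cstar_algebra \<Rightarrow> 'h::complex_banach \<Rightarrow> 'h"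
    and ip :: "'h \<Rightarrow> 'h \<Rightarrow> 'a"
    and H :: "nat \<Rightarrow> 'h set"
    and \<omega> :: "nat \<Rightarrow> 'a"
  assumes "hilbert_module act ip"
    and "\<And>n. n \<ge> 1 \<Longrightarrow> orth_complemented act ip (H n)"
    and "weight \<omega>"
  shows "star_fusion_frame act ip H \<omega> \<longleftrightarrow>
    (\<forall>x. summable (\<lambda>n. frame_term ip H \<omega> x (Suc n))) \<and>
    (\<exists>c d :: real. c > 0 \<and> d > 0 \<and>
      (\<forall>x. c * norm x ^ 2 \<le> norm (\<Sum>n. frame_term ip H \<omega> x (Suc n)) \<and>
           norm (\<Sum>n. frame_term ip H \<omega> x (Suc n)) \<le> d * norm x ^ 2))"
proof (cases "\<forall>x. summable (\<lambda>n. frame_term ip H \<omega> x (Suc n))")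
  case False
  then show ?thesis unfolding star_fusion_frame_def by blast
next
  case summ: True
  interpret hilbert_module act ip by fact
  define q where "q x = (\<Sum>n. frame_term ip H \<omega> x (Suc n))" for x
  have q_pos: "positive (q x)" for x
    unfolding q_def using summ by (intro positive_suminf positive_frame_term assms) auto
  have q_act: "q (act a x) = a * q x * star a" for a x
  proof -
    have "bounded_linear (\<lambda>b. a * b * star a)"
      by (rule bounded_linear_compose[OF bounded_linear_mult_left bounded_linear_mult_right])
    then have "a * q x * star a = (\<Sum>n. a * frame_term ip H \<omega> x (Suc n) * star a)"
      unfolding q_def using bounded_linear.suminf summ by blast
    also have "\<dots> = q (act a x)" unfolding q_def by (simp add: frame_term_act assms)
    finally show ?thesis by simp
  qed
  have ineq: "modulus ip (act a x) ^ 2 \<preceq> q x \<longleftrightarrow> positive (q x - a * ip x x * star a)"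
    "q x \<preceq> modulus ip (act a x) ^ 2 \<longleftrightarrow> positive (a * ip x x * star a - q x)" for a x
    unfolding cstar_le_def modulus_square ip_act_act by auto
  have "(\<exists>A B. strictly_positive A \<and> strictly_positive B \<and>
      (\<forall>x. modulus ip (act A x) ^ 2 \<preceq> q x \<and> q x \<preceq> modulus ip (act B x) ^ 2)) \<longleftrightarrow>
    (\<exists>c d :: real. c > 0 \<and> d > 0 \<and>
      (\<forall>x. c * norm x ^ 2 \<le> norm (q x) \<and> norm (q x) \<le> d * norm x ^ 2))" (is "?L \<longleftrightarrow> ?R")
  proof
    assume ?L
    then obtain A B where AB: "strictly_positive A" "strictly_positive B"
      "\<And>x. positive (q x - A * ip x x * star A)" "\<And>x. positive (B * ip x x * star B - q x)"
      unfolding ineq by blast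
    have conj: "norm (a * b * star a) \<le> norm a ^ 2 * norm b" for a b :: 'a
    proof -
      have "norm (a * b * star a) \<le> norm (a * b) * norm a" using norm_mult_ineq[of "a * b" "star a"] by simp
      also have "\<dots> \<le> norm a * norm b * norm a" by (intro mult_right_mono norm_mult_ineq) simp
      finally show ?thesis by (simp add: power2_eq_square mult_ac)
    qed
    obtain A' where A': "A' * A = 1"
      using strictly_positive_self_adjoint_invertible(2)[OF AB(1)] unfolding alg_invertible_def by blast
    \<comment> \<open>In the zero algebra \<open>A'\<close> and \<open>B\<close> vanish; the
      \<open>+ 1\<close> keeps \<open>K\<close> and \<open>d\<close> positive there.\<close>
    define K where "K = norm A' ^ 2 + 1"
    define d where "d = norm B ^ 2 + 1"
    have Kd: "0 < K" "0 < d" unfolding K_def d_def by (simp_all add: add_nonneg_pos)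
    have "norm (q x) \<le> d * norm x ^ 2" for x
    proof -
      have "norm (q x) \<le> norm (B * ip x x * star B)" by (rule positive_norm_mono[OF q_pos AB(4)])
      also have "\<dots> \<le> norm B ^ 2 * norm (ip x x)" by (rule conj)
      also have "\<dots> \<le> d * norm (ip x x)" unfolding d_def by (intro mult_right_mono) auto
      finally show ?thesis by (simp add: norm_square)
    qed
    moreover have "(1 / K) * norm x ^ 2 \<le> norm (q x)" for x
    proof -
      have "star A * star A' = 1" using arg_cong[OF A', of star] by (simp add: star_mult)
      \<comment> \<open>Undoing the conjugation by \<open>A\<close> bounds \<open>ip x x\<close> by
        a multiple of \<open>A * ip x x * star A\<close>, which lies below
        \<open>q x\<close>.\<close>
      then have "ip x x = A' * (A * ip x x * star A) * star A'"
        using A' by (metis mult.assoc mult_1_left mult_1_right)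
      then have "norm (ip x x) \<le> norm A' ^ 2 * norm (A * ip x x * star A)" by (metis conj)
      also have "\<dots> \<le> K * norm (q x)"
        unfolding K_def using positive_norm_mono[OF _ AB(3), of x] ip_positive[of "act A x"]
        by (intro mult_mono) (auto simp: ip_act_act)
      finally show ?thesis using Kd by (simp add: norm_square field_simps)
    qed
    ultimately show ?R using Kd by (intro exI[of _ "1 / K"] exI[of _ d]) auto
  next
    assume ?R
    then obtain c d :: real where cd: "c > 0" "d > 0"
      "\<And>x. c * norm (ip x x) \<le> norm (q x)" "\<And>x. norm (q x) \<le> d * norm (ip x x)"
      unfolding norm_square by blast
    have low: "positive (q x - c *\<^sub>R ip x x)" for x
    proof -
      \<comment> \<open>For the lower bound \<open>q\<close> is the dominating map, with ratio
        \<open>1 / c\<close>; the result is then rescaled by \<open>c\<close>.\<close>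
      have "norm (ip x x) \<le> (1 / c) * norm (q x)" for x using cd(1) cd(3)[of x] by (simp add: field_simps)
      then have "positive ((1 / c) *\<^sub>R q x - ip x x)"
        using cd(1) order_bound_if_norm_bound[of "\<lambda>x. ip x x" q act "1 / c"]
        by (simp add: ip_positive q_pos ip_act_act q_act)
      then have "positive (c *\<^sub>R ((1 / c) *\<^sub>R q x - ip x x))" using cd(1) by (intro positive_scaleR) auto
      then show ?thesis using cd(1) by (simp add: scaleR_diff_right)
    qed
    have up: "positive (d *\<^sub>R ip x x - q x)" for x
      using cd(2,4) order_bound_if_norm_bound[of q "\<lambda>x. ip x x" act d]
      by (simp add: ip_positive q_pos ip_act_act q_act)
    have sq: "(sqrt r *\<^sub>R 1) * b * star (sqrt r *\<^sub>R 1) = r *\<^sub>R b" if "0 < r" for r and b :: 'a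
      using that by (simp add: star_scaleR)
    show ?L
      \<comment> \<open>Square roots appear because a frame bound acts by conjugation, so
        \<open>sqrt c *\<^sub>R 1\<close> multiplies \<open>ip x x\<close> by
        \<open>c\<close>.\<close>
      by (rule exI[of _ "sqrt c *\<^sub>R 1"], rule exI[of _ "sqrt d *\<^sub>R 1"])
         (use cd(1,2) low up in \<open>simp add: ineq sq strictly_positive_scaleR_one del: mult_scaleR_left star_scaleR\<close>)
  qed
  then show ?thesis unfolding star_fusion_frame_def using summ by (simp flip: q_def)
qed

end
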